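(* For any integer $n>0$, we have $$\mathrm{grFrob}\Big(\mathbb{C}\big[\mathbf{x}_{\binom{[n]}{2}}\big]\big/J(n);q\Big)=\sum_{d=0}^{\lfloor n/4\rfloor}q^d\cdot s_{(n-2d,2d)}.$$
   Context: Let $[n]=\{1,\dots,n\}$ and let $\binom{[n]}{2}$ be the set of 2-element subsets of $[n]$. Let $\mathbb{C}\big[\mathbf{x}_{\binom{[n]}{2}}\big]$ be the polynomial ring in the variables $x_{\{i,j\}}=x_{\{j,i\}}$ indexed by $\binom{[n]}{2}$. The symmetric group $\mathfrak{S}_n$ acts on it by the graded algebra automorphisms determined by $w\cdot x_{\{i,j\}}=x_{\{w(i),w(j)\}}$. $I(n)\subseteq\mathbb{C}\big[\mathbf{x}_{\binom{[n]}{2}}\big]$ is the ideal generated by all sums $\sum_{j\in[n],\,j\neq i}x_{\{i,j\}}$ for $i\in[n]$, and all products $x_S\cdot x_T$ for $S,T\in\binom{[n]}{2}$ with $S\cap T\neq\varnothing$ ($S$ may equal $T$). The ideal $J(n)$ is $$J(n)=I(n)+\langle x_{\{i,j\}}\cdot x_{\{k,l\}}-x_{\{i,k\}}\cdot x_{\{j,l\}}: i,j,k,l\in[n]\text{ are pairwise distinct}\rangle.$$ It is homogeneous and $\mathfrak{S}_n$-stable, so the quotient is a graded $\mathfrak{S}_n$-module. If an $\mathfrak{S}_n$-module $V\cong\bigoplus_{\lambda\vdash n}(V^\lambda)^{\oplus c_\lambda}$, with $V^\lambda$ the Specht modules (irreducibles), then $\mathrm{Frob}(V)=\sum_\lambda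 c_\lambda s_\lambda$ ($s_\lambda$ the Schur function). For graded $V=\bigoplus_d V_d$, $\mathrm{grFrob}(V;q)=\sum_d q^d\,\mathrm{Frob}(V_d)$. Trailing zeros in partitions are ignored. *)

theory Defs
  imports
    "HOL-Algebra.QuotRing"
    "HOL-Algebra.Algebraic_Closure_Type"
    "HOL-Combinatorics.Permutations"
    "HOL-Computational_Algebra.Polynomial"
    "HOL-Library.FuncSet"
    "HOL-Library.Function_Algebras"
    "HOL-Library.Poly_Mapping"
begin

section \<open>Linear extension of maps on basis elements\<close>

text \<open>
  A finitely supported function \<open>p\<close> stands for the formal linear combination
  \<open>\<Sum>k. lookup p k \<cdot> k\<close>; each basis element \<open>k\<close> is replaced by \<open>f k\<close>.
\<close>
definition pushforward :: "('a \<Rightarrow> 'b) \<Rightarrow> ('a \<Rightarrow>\<^sub>0 'c::comm_monoid_add) \<Rightarrow> ('b \<Rightarrow>\<^sub>0 'c)" where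
  "pushforward f p =
    (\<Sum>k\<in>Poly_Mapping.keys p. Poly_Mapping.single (f k) (Poly_Mapping.lookup p k))"

definition pm_scale :: "complex \<Rightarrow> ('a \<Rightarrow>\<^sub>0 complex) \<Rightarrow> ('a \<Rightarrow>\<^sub>0 complex)" where
  "pm_scale c = Poly_Mapping.map ((*) c)"

lemma pushforward_superset:
  assumes "finite A" "Poly_Mapping.keys p \<subseteq> A"
  shows "pushforward f p = (\<Sum>k\<in>A. Poly_Mapping.single (f k) (Poly_Mapping.lookup p k))"
  unfolding pushforward_def
  using assms by (intro sum.mono_neutral_left) (auto simp: in_keys_iff)

lemma pushforward_single [simp]:
  "pushforward f (Poly_Mapping.single k c) = Poly_Mapping.single (f k) c"
  by (simp add: pushforward_superset[of "{k}"])

lemma pushforward_zero [simp]: "pushforward f 0 = 0"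
  by (simp add: pushforward_def)

lemma pushforward_add: "pushforward f (p + q) = pushforward f p + pushforward f q"
proof -
  have "Poly_Mapping.keys (p + q) \<subseteq> Poly_Mapping.keys p \<union> Poly_Mapping.keys q"
    by (rule Poly_Mapping.keys_add)
  then show ?thesis
    by (simp add: pushforward_superset[of "Poly_Mapping.keys p \<union> Poly_Mapping.keys q"] lookup_add
        single_add sum.distrib)
qed

lemma pm_induct [case_names zero add_single]:
  fixes p :: "'a \<Rightarrow>\<^sub>0 'b::comm_monoid_add"
  assumes "P 0" and "\<And>p k c. P p \<Longrightarrow> P (p + Poly_Mapping.single k c)"
  shows "P p"
proof (induction p rule: Poly_Mapping.update_induct)
  case const
  show ?case by (rule assms(1))
next
  case (update f a b)
  then have "Poly_Mapping.update a b f = f + Poly_Mapping.single a b"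
    by (intro poly_mapping_eqI)
      (auto simp: lookup_update lookup_add lookup_single when_def in_keys_iff)
  then show ?case using assms(2) update by simp
qed

section \<open>The polynomial ring and its ideals\<close>

definition edges :: "nat \<Rightarrow> nat set set" where
  "edges n = {S. S \<subseteq> {1..n} \<and> card S = 2}"

text \<open>
  Monomials are finitely supported exponent functions on the variables, and polynomials are
  finitely supported coefficient functions on the monomials; the type admits a variable for
  every set of natural numbers, and \<open>edge_poly_ring n\<close> is the subring of the
  polynomials in the variables indexed by \<open>edges n\<close>.
\<close>
type_synonym mono = "nat set \<Rightarrow>\<^sub>0 nat"
type_synonym mpoly = "mono \<Rightarrow>\<^sub>0 complex"

definition xvar :: "nat set \<Rightarrow> mpoly" where
  "xvar S = Poly_Mapping.single (Poly_Mapping.single S 1) 1"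

definition edge_poly_ring :: "nat \<Rightarrow> mpoly ring" where
  "edge_poly_ring n = ring_of_type_algebra
     \<lparr>carrier := {p. \<forall>m\<in>Poly_Mapping.keys p. Poly_Mapping.keys m \<subseteq> edges n}\<rparr>"

definition homogeneous :: "nat \<Rightarrow> mpoly \<Rightarrow> bool" where
  "homogeneous d p \<longleftrightarrow>
    (\<forall>m\<in>Poly_Mapping.keys p. (\<Sum>S\<in>Poly_Mapping.keys m. Poly_Mapping.lookup m S) = d)"

definition perm_mono :: "(nat \<Rightarrow> nat) \<Rightarrow> mono \<Rightarrow> mono" where
  "perm_mono w = pushforward ((`) w)"

definition perm_poly :: "(nat \<Rightarrow> nat) \<Rightarrow> mpoly \<Rightarrow> mpoly" where
  "perm_poly w = pushforward (perm_mono w)"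

text \<open>
  \<open>perm_poly w\<close> is the algebra endomorphism with \<open>xvar S \<mapsto> xvar (w ` S)\<close>.
\<close>
lemma perm_poly_xvar: "perm_poly w (xvar S) = xvar (w ` S)"
  by (simp add: perm_poly_def perm_mono_def xvar_def)

lemma perm_poly_const:
  "perm_poly w (Poly_Mapping.single 0 c) = Poly_Mapping.single 0 c"
  by (simp add: perm_poly_def perm_mono_def)

lemma perm_poly_add: "perm_poly w (p + q) = perm_poly w p + perm_poly w q"
  by (simp add: perm_poly_def pushforward_add)

lemma perm_poly_mult: "perm_poly w (p * q) = perm_poly w p * perm_poly w q"
proof -
  have single: "perm_poly w (Poly_Mapping.single a c * q) =
      perm_poly w (Poly_Mapping.single a c) * perm_poly w q" for a c q
  proof (induction q rule: pm_induct)
    case zero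
    show ?case by (simp add: perm_poly_def)
  next
    case (add_single q k d)
    have "perm_poly w (Poly_Mapping.single a c * Poly_Mapping.single k d) =
        perm_poly w (Poly_Mapping.single a c) * perm_poly w (Poly_Mapping.single k d)"
      by (simp add: perm_poly_def mult_single perm_mono_def pushforward_add)
    with add_single show ?case by (simp add: distrib_left perm_poly_add)
  qed
  show ?thesis
  proof (induction p rule: pm_induct)
    case zero
    show ?case by (simp add: perm_poly_def)
  next
    case (add_single p k d)
    then show ?case by (simp add: distrib_right perm_poly_add single)
  qed
qed

definition I_gens :: "nat \<Rightarrow> mpoly set" where
  "I_gens n = {(\<Sum>j\<in>{1..n} - {i}. xvar {i, j}) | i. i \<in> {1..n}}
     \<union> {xvar S * xvar T | S T. S \<in> edges n \<and> T \<in> edges n \<and> S \<inter> T \<noteq> {}}"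

definition I_ideal :: "nat \<Rightarrow> mpoly set" where
  "I_ideal n = Idl\<^bsub>edge_poly_ring n\<^esub> (I_gens n)"

definition swap_gens :: "nat \<Rightarrow> mpoly set" where
  "swap_gens n = {xvar {i, j} * xvar {k, l} - xvar {i, k} * xvar {j, l} | i j k l.
     {i, j, k, l} \<subseteq> {1..n} \<and> distinct [i, j, k, l]}"

definition J_ideal :: "nat \<Rightarrow> mpoly set" where
  "J_ideal n = I_ideal n <+>\<^bsub>edge_poly_ring n\<^esub> Idl\<^bsub>edge_poly_ring n\<^esub> (swap_gens n)"

section \<open>Modules over the symmetric group\<close>

record 'a Sn_mod = "(complex, 'a) module" +
  act :: "(nat \<Rightarrow> nat) \<Rightarrow> 'a \<Rightarrow> 'a"

locale Sn_module = module "ring_of_type_algebra :: complex ring" V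
  for n :: nat and V :: "'a Sn_mod" (structure) +
  assumes act_closed: "w permutes {1..n} \<Longrightarrow> v \<in> carrier V \<Longrightarrow> act V w v \<in> carrier V"
    and act_add: "w permutes {1..n} \<Longrightarrow> u \<in> carrier V \<Longrightarrow> v \<in> carrier V \<Longrightarrow>
      act V w (u \<oplus> v) = act V w u \<oplus> act V w v"
    and act_smult: "w permutes {1..n} \<Longrightarrow> v \<in> carrier V \<Longrightarrow>
      act V w (c \<odot>\<^bsub>V\<^esub> v) = c \<odot>\<^bsub>V\<^esub> act V w v"
    and act_id: "v \<in> carrier V \<Longrightarrow> act V id v = v"
    and act_comp: "w permutes {1..n} \<Longrightarrow> w' permutes {1..n} \<Longrightarrow> v \<in> carrier V \<Longrightarrow>
      act V (w \<circ> w') v = act V w (act V w' v)"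

definition Sn_iso :: "nat \<Rightarrow> 'a Sn_mod \<Rightarrow> 'b Sn_mod \<Rightarrow> bool" where
  "Sn_iso n V W \<longleftrightarrow> (\<exists>h. bij_betw h (carrier V) (carrier W) \<and>
     (\<forall>u\<in>carrier V. \<forall>v\<in>carrier V. h (u \<oplus>\<^bsub>V\<^esub> v) = h u \<oplus>\<^bsub>W\<^esub> h v) \<and>
     (\<forall>c. \<forall>v\<in>carrier V. h (c \<odot>\<^bsub>V\<^esub> v) = c \<odot>\<^bsub>W\<^esub> h v) \<and>
     (\<forall>w v. w permutes {1..n} \<longrightarrow> v \<in> carrier V \<longrightarrow> h (act V w v) = act W w (h v)))"

text \<open>
  The quotient of the polynomial ring by \<open>J_ideal n\<close>; elements are cosets, scalars act
  through the constant polynomials and permutations act on a coset elementwise.  The fields for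
  ring multiplication are kept from the quotient ring.
\<close>
definition quotient_module :: "nat \<Rightarrow> mpoly set Sn_mod" where
  "quotient_module n = (let R = edge_poly_ring n; Q = R Quot J_ideal n in
     \<lparr>carrier = carrier Q, monoid.mult = monoid.mult Q, one = one Q,
      ring.zero = ring.zero Q, add = add Q,
      module.smult = (\<lambda>c U. (J_ideal n +>\<^bsub>R\<^esub> Poly_Mapping.single 0 c) \<otimes>\<^bsub>Q\<^esub> U),
      act = (\<lambda>w U. perm_poly w ` U)\<rparr>)"

definition quotient_component :: "nat \<Rightarrow> nat \<Rightarrow> mpoly set Sn_mod" where
  "quotient_component n d = quotient_module n
     \<lparr>carrier := {J_ideal n +>\<^bsub>edge_poly_ring n\<^esub> p | p.
        p \<in> carrier (edge_poly_ring n) \<and> homogeneous d p}\<rparr>"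

section \<open>Partitions, Specht modules and Schur functions\<close>

definition partitions :: "nat \<Rightarrow> nat list set" where
  "partitions n = {lam. sorted_wrt (\<ge>) lam \<and> 0 \<notin> set lam \<and> sum_list lam = n}"

text \<open>
  Young diagrams, with rows and columns numbered from 0; trailing zeros of \<open>lam\<close> do not
  affect the diagram.
\<close>
definition young :: "nat list \<Rightarrow> (nat \<times> nat) set" where
  "young lam = {(i, j). i < length lam \<and> j < lam ! i}"

definition tableau :: "nat \<Rightarrow> nat list \<Rightarrow> (nat \<times> nat \<Rightarrow> nat) \<Rightarrow> bool" where
  "tableau n lam t \<longleftrightarrow> bij_betw t (young lam) {1..n}"

text \<open>The tabloid of a tableau is the list of its row sets.\<close>
definition tabloid :: "nat list \<Rightarrow> (nat \<times> nat \<Rightarrow> nat) \<Rightarrow> nat set list" where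
  "tabloid lam t = map (\<lambda>i. (\<lambda>j. t (i, j)) ` {..<lam ! i}) [0..<length lam]"

definition column_stabilizer ::
    "nat \<Rightarrow> nat list \<Rightarrow> (nat \<times> nat \<Rightarrow> nat) \<Rightarrow> (nat \<Rightarrow> nat) set" where
  "column_stabilizer n lam t = {p. p permutes {1..n} \<and>
     (\<forall>(i, j)\<in>young lam. \<exists>i'. (i', j) \<in> young lam \<and> p (t (i, j)) = t (i', j))}"

definition polytabloid ::
    "nat \<Rightarrow> nat list \<Rightarrow> (nat \<times> nat \<Rightarrow> nat) \<Rightarrow> (nat set list \<Rightarrow>\<^sub>0 complex)" where
  "polytabloid n lam t = (\<Sum>p\<in>column_stabilizer n lam t.
     Poly_Mapping.single (tabloid lam (p \<circ> t)) (of_int (sign p)))"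

text \<open>
  The Specht module is the span of the polytabloids inside the permutation module on tabloids.
  The ring fields \<open>mult\<close> and \<open>one\<close> of the record play no role for modules.
\<close>
definition specht :: "nat \<Rightarrow> nat list \<Rightarrow> (nat set list \<Rightarrow>\<^sub>0 complex) Sn_mod" where
  "specht n lam =
     \<lparr>carrier = module.span pm_scale {polytabloid n lam t | t. tableau n lam t},
      monoid.mult = undefined, one = undefined, ring.zero = 0, add = (+),
      module.smult = pm_scale,
      act = (\<lambda>w. pushforward (map ((`) w)))\<rparr>"

text \<open>
  The direct sum over all partitions \<open>lam\<close> of \<open>n\<close> of \<open>c lam\<close> copies of the Specht module;
  \<open>f lam k\<close> is the component of \<open>f\<close> in the \<open>k\<close>-th copy.
\<close>
definition specht_sum ::
    "nat \<Rightarrow> (nat list \<Rightarrow> nat) \<Rightarrow> (nat list \<Rightarrow> nat \<Rightarrow> (nat set list \<Rightarrow>\<^sub>0 complex)) Sn_mod" where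
  "specht_sum n c =
     \<lparr>carrier = {f. \<forall>lam k. if lam \<in> partitions n \<and> k < c lam
        then f lam k \<in> carrier (specht n lam) else f lam k = 0},
      monoid.mult = undefined, one = undefined, ring.zero = (\<lambda>lam k. 0),
      add = (\<lambda>f g lam k. f lam k \<oplus>\<^bsub>specht n lam\<^esub> g lam k),
      module.smult = (\<lambda>a f lam k. a \<odot>\<^bsub>specht n lam\<^esub> f lam k),
      act = (\<lambda>w f lam k. act (specht n lam) w (f lam k))\<rparr>"

text \<open>
  Symmetric functions are given by their coefficients as formal power series in countably many
  variables, indexed by \<open>nat\<close>.  Only their additive structure is used, which agrees with
  the pointwise one on the function type.
\<close>
type_synonym symfun = "(nat \<Rightarrow>\<^sub>0 nat) \<Rightarrow> int"

definition ssyt :: "nat list \<Rightarrow> (nat \<times> nat \<Rightarrow> nat) set" where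
  "ssyt lam = {T \<in> young lam \<rightarrow>\<^sub>E UNIV.
     (\<forall>i j. (i, Suc j) \<in> young lam \<longrightarrow> T (i, j) \<le> T (i, Suc j)) \<and>
     (\<forall>i j. (Suc i, j) \<in> young lam \<longrightarrow> T (i, j) < T (Suc i, j))}"

text \<open>
  The coefficient at a monomial \<open>m\<close> is the number of semistandard tableaux whose
  content is \<open>m\<close>.
\<close>
definition schur :: "nat list \<Rightarrow> symfun" where
  "schur lam = (\<lambda>m. int (card {T \<in> ssyt lam.
     (\<Sum>b\<in>young lam. Poly_Mapping.single (T b) 1) = m}))"

section \<open>Frobenius images\<close>

text \<open>
  \<open>has_Frob n V f\<close> says that \<open>V\<close> is an \<open>S\<^sub>n\<close>-module that decomposes into Specht modules
  and has Frobenius image \<open>f\<close>.  For a graded module, given by its homogeneous components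
  \<open>V d\<close>, the graded Frobenius image is a polynomial in \<open>q\<close> whose coefficients are symmetric
  functions.
\<close>
definition has_Frob :: "nat \<Rightarrow> 'a Sn_mod \<Rightarrow> symfun \<Rightarrow> bool" where
  "has_Frob n V f \<longleftrightarrow> Sn_module n V \<and>
     (\<exists>c. Sn_iso n V (specht_sum n c) \<and>
          f = (\<lambda>m. \<Sum>lam\<in>partitions n. int (c lam) * schur lam m))"

definition has_grFrob :: "nat \<Rightarrow> (nat \<Rightarrow> 'a Sn_mod) \<Rightarrow> symfun poly \<Rightarrow> bool" where
  "has_grFrob n V F \<longleftrightarrow> (\<forall>d. has_Frob n (V d) (Polynomial.coeff F d))"

end

theory Submission
  imports Defs
begin

text \<open>
  Fix \<open>d\<close> and put \<open>k = 2 d\<close>.  Modulo the products of intersecting variables, the polynomials of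
  degree \<open>d\<close> are spanned by the monomials of matchings with \<open>d\<close> edges.  The swap relations identify
  any two matchings that cover the same set (\<open>matching_poly_cong\<close>): a swap moves an edge of the first
  matching into the second one, and the common edge is then removed from both.  Hence the component
  of degree \<open>d\<close> is spanned by classes \<open>y\<^sub>T\<close>, one for each \<open>k\<close>-subset \<open>T\<close> of \<open>{1..n}\<close>.  Multiplied by
  matchings with \<open>d - 1\<close> edges, the linear generators become the relations
  \<open>\<Sum>c\<in>{1..n} - W. y\<^bsub>insert c W\<^esub> = 0\<close> for the sets \<open>W\<close> with \<open>k - 1\<close> elements
  (\<open>sum_set_poly_mem\<close>).  So the component is the permutation module \<open>M\<close> on the \<open>k\<close>-subsets, which are
  the tabloids of shape \<open>(n - k, k)\<close>, modulo the image \<open>U\<close> of the map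
  \<open>W \<mapsto> \<Sum>c\<in>{1..n} - W. insert c W\<close>.  The theorem holds because the Specht module \<open>S \<subseteq> M\<close> is a
  complement of \<open>U\<close>.
  
  \<open>M = S + U\<close> (\<open>mem_if_alt_mem\<close>): a polytabloid is an alternating sum over \<open>k\<close> disjoint pairs of
  points.  Consider alternating sums over fewer pairs, the remaining elements of the sets being fixed.
  By downward induction on the number of pairs, all of them lie in \<open>S + U\<close>: by the induction
  hypothesis a fixed element may be replaced by any free point without changing the sum modulo
  \<open>S + U\<close>, while the sum over all such replacements lies in \<open>U\<close>.  With no pairs left this says
  \<open>T \<in> S + U\<close>.
  
  \<open>S \<inter> U = 0\<close> (\<open>to_poly_mem_J_imp_0\<close>): the coefficients of \<open>v \<in> S\<close> add up to zero over all
  \<open>k\<close>-subsets that contain a given \<open>W\<close>, which is orthogonality to \<open>U\<close>.  Therefore the functional that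
  sends a matching covering \<open>T\<close> to the complex conjugate of the coefficient of \<open>v\<close> at \<open>T\<close> is zero on
  the ideal (\<open>matching_functional_vanishes\<close>).  Its value at the image of \<open>v\<close> is the sum of the squared
  absolute values of the coefficients of \<open>v\<close>, so \<open>v = 0\<close> if that image lies in the ideal.
  
  If \<open>n < 4 d\<close>, there are no \<open>k\<close> disjoint pairs in \<open>{1..n}\<close>.  Then \<open>S = 0\<close>, and the first argument shows
  that the component is zero.  The isomorphism from \<open>S\<close> to the component (\<open>to_poly\<close>, followed by the
  projection to the quotient) respects the group action since a permutation carries a matching of \<open>T\<close>
  to one of the image of \<open>T\<close>.
\<close>

section \<open>Alternating sums over disjoint pairs\<close>

text \<open>
  The signed sum of \<open>\<phi> (F \<union> Y)\<close> over the sets \<open>Y\<close> that pick one entry of each pair; each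
  second entry contributes a factor \<open>-1\<close>.  Such sums are polytabloids when \<open>\<phi>\<close> is the family of
  two-row tabloids.
\<close>
fun alt :: "('b \<times> 'b) list \<Rightarrow> 'b set \<Rightarrow> ('b set \<Rightarrow> 'v::ab_group_add) \<Rightarrow> 'v" where
  "alt [] F \<phi> = \<phi> F"
| "alt ((a, b) # ps) F \<phi> = alt ps (insert a F) \<phi> - alt ps (insert b F) \<phi>"

definition ends :: "('b \<times> 'b) list \<Rightarrow> 'b list" where
  "ends ps = map fst ps @ map snd ps"

lemma ends_Nil [simp]: "ends [] = []"
  by (simp add: ends_def)

lemma set_ends_Cons [simp]: "set (ends ((a, b) # ps)) = insert a (insert b (set (ends ps)))"
  by (auto simp: ends_def)

lemma distinct_ends_Cons [simp]:
  "distinct (ends ((a, b) # ps)) \<longleftrightarrow>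
     a \<noteq> b \<and> a \<notin> set (ends ps) \<and> b \<notin> set (ends ps) \<and> distinct (ends ps)"
  by (auto simp: ends_def)

lemma length_ends [simp]: "length (ends ps) = 2 * length ps"
  by (simp add: ends_def)

lemma alt_additive:
  assumes "\<And>x y. h (x - y) = h x - h y"
  shows "h (alt ps F \<phi>) = alt ps F (\<lambda>T. h (\<phi> T))"
  by (induction ps F \<phi> rule: alt.induct) (simp_all add: assms)

lemma alt_insert: "alt ps (insert a F) \<phi> = alt ps F (\<lambda>T. \<phi> (insert a T))"
  by (induction ps F \<phi> rule: alt.induct) (simp_all add: insert_commute)

lemma alt_map: "alt (map (map_prod w w) ps) (w ` F) \<phi> = alt ps F (\<lambda>T. \<phi> (w ` T))"
  by (induction ps F "\<lambda>T. \<phi> (w ` T)" rule: alt.induct) auto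

lemma alt_eq_0:
  assumes "(a, b) \<in> set ps" and "\<And>T. \<phi> (insert a T) = \<phi> (insert b T)"
  shows "alt ps F \<phi> = 0"
  using assms
proof (induction ps arbitrary: F)
  case (Cons p ps)
  show ?case
  proof (cases "p = (a, b)")
    case True
    then show ?thesis using Cons.prems by (simp add: alt_insert)
  next
    case False
    then show ?thesis using Cons by (cases p) auto
  qed
qed simp

lemma alt_cong:
  assumes "\<And>T. F \<subseteq> T \<Longrightarrow> T \<subseteq> F \<union> set (ends ps) \<Longrightarrow> card T = card F + length ps \<Longrightarrow> \<phi> T = \<psi> T"
    and "finite F" "distinct (ends ps)" "set (ends ps) \<inter> F = {}"
  shows "alt ps F \<phi> = alt ps F \<psi>"
  using assms
proof (induction ps arbitrary: F)
  case (Cons p ps)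
  obtain a b where p: "p = (a, b)" by fastforce
  have "alt ps (insert c F) \<phi> = alt ps (insert c F) \<psi>" if "c = a \<or> c = b" for c
  proof (rule Cons.IH)
    fix T assume T: "insert c F \<subseteq> T" "T \<subseteq> insert c F \<union> set (ends ps)"
      "card T = card (insert c F) + length ps"
    have "c \<notin> F" "c \<in> set (ends (p # ps))" using Cons.prems(4) that by (auto simp: p)
    then have "card (insert c F) = Suc (card F)" "T \<subseteq> F \<union> set (ends (p # ps))"
      using Cons.prems(2) T(2) by (auto simp: p)
    then show "\<phi> T = \<psi> T" using T by (intro Cons.prems(1)) simp_all
  qed (use Cons.prems(2-) that in \<open>auto simp: p\<close>)
  then show ?case by (simp add: p)
qed simp

text \<open>
  Pigeonhole: disjoint pairs that all meet \<open>W\<close> are at most as many as the elements of \<open>W\<close>.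
\<close>
lemma exists_missed_pair:
  assumes "distinct (ends ps)" "card W < length ps" "finite W"
  shows "\<exists>(a, b) \<in> set ps. a \<notin> W \<and> b \<notin> W"
  using assms
proof (induction ps arbitrary: W)
  case (Cons p ps)
  obtain a b where p: "p = (a, b)" by fastforce
  show ?case
  proof (cases "a \<notin> W \<and> b \<notin> W")
    case False
    then have "W - {a, b} \<subset> W" by auto
    then have "card (W - {a, b}) < card W" using Cons.prems by (intro psubset_card_mono) auto
    then obtain a' b' where *: "(a', b') \<in> set ps" "a' \<notin> W - {a, b}" "b' \<notin> W - {a, b}"
      using Cons.IH[of "W - {a, b}"] Cons.prems unfolding p by auto
    moreover have "a' \<in> set (ends ps)" "b' \<in> set (ends ps)"
      using * by (force simp: ends_def)+
    ultimately show ?thesis using Cons.prems unfolding p by auto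
  qed (auto simp: p)
qed simp

lemma insert_eq_card_Suc:
  assumes "finite T" "card T = Suc (card W)" "W \<subseteq> T"
  obtains c where "c \<notin> W" "T = insert c W"
proof -
  have "card (T - W) = 1" using assms by (simp add: card_Diff_subset finite_subset)
  then obtain c where "T - W = {c}" by (auto simp: card_1_singleton_iff)
  then show ?thesis using assms that[of c] by auto
qed

text \<open>
  The possible columns of length two in a tableau of shape \<open>(n - k, k)\<close>, lower entry first.
\<close>
definition pair_lists :: "nat \<Rightarrow> nat \<Rightarrow> (nat \<times> nat) list set" where
  "pair_lists n k = {ps. length ps = k \<and> distinct (ends ps) \<and> set (ends ps) \<subseteq> {1..n}}"

lemma alt_sum: "alt ps F (\<lambda>T. \<Sum>c\<in>A. \<psi> c T) = (\<Sum>c\<in>A. alt ps F (\<psi> c))"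
  by (induction ps arbitrary: F) (auto simp: sum_subtractf)

text \<open>
  The coefficients of an alternating sum add up to zero over all sets of the form \<open>insert c W\<close>:
  collecting them gives the alternating sum of the indicator of \<open>W \<subseteq> T\<close>, and some pair misses \<open>W\<close>,
  so that exchanging its entries affects the sign but not this indicator.
\<close>
lemma sum_alt_indicator:
  assumes "finite E" "W \<subseteq> E" "distinct (ends ps)" "set (ends ps) \<subseteq> E" "Suc (card W) = length ps"
  shows "(\<Sum>c\<in>E - W. alt ps {} (\<lambda>T. if T = insert c W then 1 else 0)) = (0 :: complex)"
proof -
  have finW: "finite W" using assms finite_subset by blast
  have ind: "(\<Sum>c\<in>E - W. if T = insert c W then 1 else 0) = (if W \<subseteq> T then 1 else 0 :: complex)"
    if T: "T \<subseteq> set (ends ps)" "card T = length ps" for T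
  proof (cases "W \<subseteq> T")
    case True
    have "finite T" using T finite_subset by blast
    then obtain c where c: "c \<notin> W" "T = insert c W"
      using insert_eq_card_Suc[of T W] T True assms(5) by auto
    then have "(\<Sum>c'\<in>E - W. if T = insert c' W then 1 else 0) =
        (\<Sum>c'\<in>E - W. if c' = c then 1 else (0::complex))"
      by (intro sum.cong) auto
    also have "\<dots> = 1" using assms c T by auto
    finally show ?thesis using True by simp
  qed (auto intro!: sum.neutral)
  obtain a b where ab: "(a, b) \<in> set ps" "a \<notin> W" "b \<notin> W"
    using exists_missed_pair[of ps W] assms finW by auto
  have "(\<Sum>c\<in>E - W. alt ps {} (\<lambda>T. if T = insert c W then 1 else 0)) =
      alt ps {} (\<lambda>T. \<Sum>c\<in>E - W. if T = insert c W then 1 else (0::complex))"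
    by (rule alt_sum[symmetric])
  also have "\<dots> = alt ps {} (\<lambda>T. if W \<subseteq> T then 1 else 0)"
    using assms ind by (intro alt_cong) auto
  also have "\<dots> = 0"
    using ab by (intro alt_eq_0[OF ab(1)]) auto
  finally show ?thesis .
qed

context vector_space
begin

text \<open>
  The relation \<open>up\<close> survives alternation.  For a pair \<open>(a, b)\<close>, the relation for the shorter list
  with \<open>a\<close> fixed has one surplus term, where the free point is \<open>b\<close>; the relation with \<open>b\<close> fixed
  has the surplus term where it is \<open>a\<close>.  Both terms insert \<open>a\<close> and \<open>b\<close>, so they cancel in the
  difference.
\<close>
lemma sum_alt_insert_mem:
  assumes N: "subspace N" and E: "finite E"
    and up: "\<And>W. W \<subseteq> E \<Longrightarrow> card W = m + length ps \<Longrightarrow> (\<Sum>c\<in>E - W. \<phi> (insert c W)) \<in> N"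
    and ps: "distinct (ends ps)" "set (ends ps) \<subseteq> E"
    and F: "F \<subseteq> E" "F \<inter> set (ends ps) = {}" "card F = m"
  shows "(\<Sum>c\<in>E - F - set (ends ps). alt ps (insert c F) \<phi>) \<in> N"
  using up ps F
proof (induction ps arbitrary: F m)
  case Nil
  then show ?case by auto
next
  case (Cons p ps)
  obtain a b where p: "p = (a, b)" by fastforce
  have finF: "finite F" using Cons.prems E finite_subset by blast
  define R where "R = E - F - set (ends (p # ps))"
  \<comment> \<open>Removing the pair from the alternation frees one further position \<open>y\<close> besides \<open>R\<close>.\<close>
  have split: "(\<Sum>c\<in>R. alt ps (insert c (insert x F)) \<phi>) + alt ps (insert y (insert x F)) \<phi> \<in> N"
    if xy: "(x, y) = (a, b) \<or> (x, y) = (b, a)" for x y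
  proof -
    have "(\<Sum>c\<in>E - insert x F - set (ends ps). alt ps (insert c (insert x F)) \<phi>) \<in> N"
      using Cons.prems xy finF unfolding p by (intro Cons.IH[of "Suc m"]) auto
    moreover have "E - insert x F - set (ends ps) = insert y R"
      using Cons.prems xy unfolding p R_def by auto
    moreover have "y \<notin> R" "finite R" using xy E unfolding p R_def by auto
    ultimately show ?thesis by (simp add: add.commute)
  qed
  have "(\<Sum>c\<in>R. alt (p # ps) (insert c F) \<phi>) =
      ((\<Sum>c\<in>R. alt ps (insert c (insert a F)) \<phi>) + alt ps (insert b (insert a F)) \<phi>) -
      ((\<Sum>c\<in>R. alt ps (insert c (insert b F)) \<phi>) + alt ps (insert a (insert b F)) \<phi>)"
    by (simp add: p sum_subtractf insert_commute)
  then show ?case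
    using subspace_diff[OF N split split, of a b b a] unfolding R_def by simp
qed

end

text \<open>
  Downward induction on the number of pairs, that is, upward on the number \<open>i\<close> of fixed points.  Let
  \<open>c\<close> be one of the fixed points and \<open>x\<close> any free point.  The alternating sum over the list enlarged
  by \<open>(c, x)\<close> shows that replacing \<open>c\<close> by \<open>x\<close> changes nothing modulo \<open>N\<close>.  The sum over all
  replacements lies in \<open>N\<close>, hence so does a positive multiple of the alternating sum itself; this is
  where characteristic zero enters.  For \<open>2 * k > card E\<close> there are no lists as in \<open>full\<close>, and the
  relation \<open>up\<close> alone suffices.
\<close>
lemma mem_if_alt_mem:
  fixes scale :: "'a::field_char_0 \<Rightarrow> 'v::ab_group_add \<Rightarrow> 'v"
  assumes vs: "vector_space scale"
    and N: "module.subspace scale N" and E: "finite E"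
    and up: "\<And>W. W \<subseteq> E \<Longrightarrow> Suc (card W) = k \<Longrightarrow> (\<Sum>c\<in>E - W. \<phi> (insert c W)) \<in> N"
    and full: "\<And>ps. length ps = k \<Longrightarrow> distinct (ends ps) \<Longrightarrow> set (ends ps) \<subseteq> E \<Longrightarrow>
      alt ps {} \<phi> \<in> N"
    and T: "T \<subseteq> E" "card T = k"
  shows "\<phi> T \<in> N"
proof -
  interpret vector_space scale by (rule vs)
  have "alt ps F \<phi> \<in> N"
    if "card F = i" "length ps + i = k" "distinct (ends ps)" "F \<subseteq> E" "set (ends ps) \<subseteq> E"
      "F \<inter> set (ends ps) = {}" for i ps F
    using that
  proof (induction i arbitrary: ps F)
    case 0
    then have "F = {}" using E finite_subset[of F E] by auto
    then show ?case using 0 full by auto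
  next
    case (Suc m)
    have finF: "finite F" using Suc.prems E finite_subset by blast
    then obtain c where c: "c \<in> F" using Suc.prems by fastforce
    define F' where "F' = F - {c}"
    have F: "F = insert c F'" "c \<notin> F'" "card F' = m" "finite F'"
      using Suc.prems c finF by (auto simp: F'_def)
    \<comment> \<open>The points that may take the place of \<open>c\<close>, including \<open>c\<close> itself, so \<open>R\<close> is nonempty.\<close>
    define R where "R = E - F' - set (ends ps)"
    have R: "finite R" "c \<in> R" using E Suc.prems F by (auto simp: R_def)
    have diff: "alt ps F \<phi> - alt ps (insert x F') \<phi> \<in> N" if x: "x \<in> R" for x
    proof (cases "x = c")
      case True
      then show ?thesis using F subspace_0[OF N] by simp
    next
      case False
      have "alt ((c, x) # ps) F' \<phi> \<in> N"
        using Suc.prems F x False unfolding R_def by (intro Suc.IH) auto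
      then show ?thesis using F by simp
    qed
    have "(\<Sum>x\<in>R. alt ps F \<phi> - alt ps (insert x F') \<phi>) \<in> N"
      using diff by (intro subspace_sum[OF N]) auto
    moreover have "(\<Sum>x\<in>R. alt ps (insert x F') \<phi>) \<in> N"
      unfolding R_def using Suc.prems F N E
      by (intro sum_alt_insert_mem[where m = m] up) auto
    ultimately have "(\<Sum>x\<in>R. alt ps F \<phi> - alt ps (insert x F') \<phi>) +
        (\<Sum>x\<in>R. alt ps (insert x F') \<phi>) \<in> N"
      by (rule subspace_add[OF N])
    then have "(\<Sum>x\<in>R. alt ps F \<phi>) \<in> N" by (simp add: sum_subtractf)
    then have "scale (of_nat (card R)) (alt ps F \<phi>) \<in> N" by (simp only: sum_constant_scale)
    then have "scale (inverse (of_nat (card R))) (scale (of_nat (card R)) (alt ps F \<phi>)) \<in> N"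
      by (rule subspace_scale[OF N])
    moreover have "card R \<noteq> 0" using R by auto
    ultimately show ?case by simp
  qed
  from this[of T k "[]"] show ?thesis using T by simp
qed

section \<open>Formal linear combinations\<close>

lemma lookup_pm_scale [simp]: "Poly_Mapping.lookup (pm_scale c p) k = c * Poly_Mapping.lookup p k"
  by (simp add: pm_scale_def Poly_Mapping.map.rep_eq when_def)

interpretation pm: vector_space pm_scale
  by unfold_locales (auto intro!: poly_mapping_eqI simp: lookup_add algebra_simps)

interpretation complex_mult: vector_space "(*) :: complex \<Rightarrow> complex \<Rightarrow> complex"
  by unfold_locales (simp_all add: algebra_simps)

lemma pm_scale_single [simp]: "pm_scale c (Poly_Mapping.single k a) = Poly_Mapping.single k (c * a)"
  by (intro poly_mapping_eqI) (simp add: lookup_single when_def)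

lemma single_0_mult: "Poly_Mapping.single 0 c * p = pm_scale c (p :: 'a::monoid_add \<Rightarrow>\<^sub>0 complex)"
  by (induction p rule: pm_induct) (simp_all add: distrib_left pm.scale_right_distrib mult_single)

lemma keys_pm_scale: "Poly_Mapping.keys (pm_scale c p) \<subseteq> Poly_Mapping.keys p"
  by (auto simp: in_keys_iff)

lemma sum_singles: "(\<Sum>k\<in>Poly_Mapping.keys p. Poly_Mapping.single k (Poly_Mapping.lookup p k)) = p"
  by (intro poly_mapping_eqI) (auto simp: lookup_sum lookup_single when_def in_keys_iff)

subsection \<open>Linear extension\<close>

definition lin_ext :: "(complex \<Rightarrow> 'v \<Rightarrow> 'v) \<Rightarrow> ('a \<Rightarrow> 'v) \<Rightarrow> ('a \<Rightarrow>\<^sub>0 complex) \<Rightarrow> 'v::ab_group_add" where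
  "lin_ext scale f p = (\<Sum>k\<in>Poly_Mapping.keys p. scale (Poly_Mapping.lookup p k) (f k))"

context
  fixes scale :: "complex \<Rightarrow> 'v::ab_group_add \<Rightarrow> 'v"
  assumes vs: "vector_space scale"
begin

interpretation vector_space scale by (rule vs)

lemma lin_ext_superset:
  assumes "finite A" "Poly_Mapping.keys p \<subseteq> A"
  shows "lin_ext scale f p = (\<Sum>k\<in>A. scale (Poly_Mapping.lookup p k) (f k))"
  unfolding lin_ext_def using assms by (intro sum.mono_neutral_left) (auto simp: in_keys_iff)

lemma lin_ext_single [simp]: "lin_ext scale f (Poly_Mapping.single k c) = scale c (f k)"
  by (subst lin_ext_superset[of "{k}"]) auto

lemma lin_ext_0 [simp]: "lin_ext scale f 0 = 0"
  by (simp add: lin_ext_def)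

lemma lin_ext_add: "lin_ext scale f (p + q) = lin_ext scale f p + lin_ext scale f q"
proof -
  have "Poly_Mapping.keys (p + q) \<subseteq> Poly_Mapping.keys p \<union> Poly_Mapping.keys q"
    by (rule Poly_Mapping.keys_add)
  then show ?thesis
    by (simp add: lin_ext_superset[of "Poly_Mapping.keys p \<union> Poly_Mapping.keys q"] lookup_add
        scale_left_distrib sum.distrib)
qed

lemma lin_ext_pm_scale: "lin_ext scale f (pm_scale c p) = scale c (lin_ext scale f p)"
  by (subst lin_ext_superset[of "Poly_Mapping.keys p" "pm_scale c p"])
    (simp_all add: keys_pm_scale lin_ext_def scale_sum_right)

lemma lin_ext_diff: "lin_ext scale f (p - q) = lin_ext scale f p - lin_ext scale f q"
  using lin_ext_add[of f "p - q" q] by simp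

lemma lin_ext_sum: "lin_ext scale f (\<Sum>i\<in>A. p i) = (\<Sum>i\<in>A. lin_ext scale f (p i))"
  by (induction A rule: infinite_finite_induct) (simp_all add: lin_ext_add)

end

lemmas pm_ext_simps = lin_ext_single[OF pm.vector_space_axioms] lin_ext_0[OF pm.vector_space_axioms]
  lin_ext_add[OF pm.vector_space_axioms] lin_ext_pm_scale[OF pm.vector_space_axioms]
  lin_ext_diff[OF pm.vector_space_axioms] lin_ext_sum[OF pm.vector_space_axioms]

lemmas fun_ext_simps = lin_ext_single[OF complex_mult.vector_space_axioms]
  lin_ext_0[OF complex_mult.vector_space_axioms]
  lin_ext_add[OF complex_mult.vector_space_axioms] lin_ext_pm_scale[OF complex_mult.vector_space_axioms]
  lin_ext_diff[OF complex_mult.vector_space_axioms] lin_ext_sum[OF complex_mult.vector_space_axioms]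

section \<open>The polynomial ring and its ideal\<close>

lemma edge_poly_ring_simps [simp]:
  "x \<otimes>\<^bsub>edge_poly_ring n\<^esub> y = x * y" "x \<oplus>\<^bsub>edge_poly_ring n\<^esub> y = x + y"
  "\<zero>\<^bsub>edge_poly_ring n\<^esub> = 0" "\<one>\<^bsub>edge_poly_ring n\<^esub> = 1"
  by (simp_all add: edge_poly_ring_def ring_of_type_algebra_def)

abbreviation edge_polys :: "nat \<Rightarrow> mpoly set" where "edge_polys n \<equiv> carrier (edge_poly_ring n)"

lemma mem_edge_polys: "p \<in> edge_polys n \<longleftrightarrow> (\<forall>m\<in>Poly_Mapping.keys p. Poly_Mapping.keys m \<subseteq> edges n)"
  by (simp add: edge_poly_ring_def)

lemma edge_polys_add [intro]: "p \<in> edge_polys n \<Longrightarrow> q \<in> edge_polys n \<Longrightarrow> p + q \<in> edge_polys n"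
  using Poly_Mapping.keys_add[of p q] by (auto simp: mem_edge_polys)

lemma edge_polys_uminus [intro]: "p \<in> edge_polys n \<Longrightarrow> - p \<in> edge_polys n"
  by (auto simp: mem_edge_polys)

lemma edge_polys_diff [intro]: "p \<in> edge_polys n \<Longrightarrow> q \<in> edge_polys n \<Longrightarrow> p - q \<in> edge_polys n"
  using edge_polys_add[of p n "- q"] by auto

lemma edge_polys_mult [intro]: "p \<in> edge_polys n \<Longrightarrow> q \<in> edge_polys n \<Longrightarrow> p * q \<in> edge_polys n"
proof -
  assume "p \<in> edge_polys n" "q \<in> edge_polys n"
  then have "Poly_Mapping.keys (a + b) \<subseteq> edges n"
    if "a \<in> Poly_Mapping.keys p" "b \<in> Poly_Mapping.keys q" for a b
    using that Poly_Mapping.keys_add[of a b] by (fastforce simp: mem_edge_polys)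
  then show ?thesis using Poly_Mapping.keys_mult[of p q] by (fastforce simp: mem_edge_polys)
qed

lemma edge_polys_single: "Poly_Mapping.keys m \<subseteq> edges n \<Longrightarrow> Poly_Mapping.single m c \<in> edge_polys n"
  by (auto simp: mem_edge_polys)

lemma edge_polys_0 [simp, intro]: "0 \<in> edge_polys n" and edge_polys_1 [simp, intro]: "1 \<in> edge_polys n"
  by (auto simp: mem_edge_polys simp flip: single_one)

lemma edge_polys_const [simp, intro]: "Poly_Mapping.single 0 c \<in> edge_polys n"
  by (rule edge_polys_single) simp

lemma edge_polys_xvar [intro]: "S \<in> edges n \<Longrightarrow> xvar S \<in> edge_polys n"
  unfolding xvar_def by (rule edge_polys_single) auto

lemma edge_polys_pm_scale [intro]: "p \<in> edge_polys n \<Longrightarrow> pm_scale c p \<in> edge_polys n"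
  using keys_pm_scale[of c p] by (auto simp: mem_edge_polys)

lemma edge_polys_sum [intro]: "(\<And>i. i \<in> A \<Longrightarrow> f i \<in> edge_polys n) \<Longrightarrow> sum f A \<in> edge_polys n"
  by (induction A rule: infinite_finite_induct) auto

lemma edge_polys_prod [intro]: "(\<And>i. i \<in> A \<Longrightarrow> f i \<in> edge_polys n) \<Longrightarrow> prod f A \<in> edge_polys n"
  by (induction A rule: infinite_finite_induct) auto

lemma cring_edge_poly_ring: "cring (edge_poly_ring n)"
proof (intro cringI abelian_groupI comm_monoidI)
  fix x assume "x \<in> edge_polys n"
  then show "\<exists>y\<in>edge_polys n. y \<oplus>\<^bsub>edge_poly_ring n\<^esub> x = \<zero>\<^bsub>edge_poly_ring n\<^esub>"
    by (intro bexI[of _ "- x"]) auto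
qed (auto simp: algebra_simps)

lemma edges_doubleton_iff: "{i, j} \<in> edges n \<longleftrightarrow> i \<in> {1..n} \<and> j \<in> {1..n} \<and> i \<noteq> j"
  by (cases "i = j") (auto simp: edges_def)

lemma I_gens_subset: "I_gens n \<subseteq> edge_polys n"
  unfolding I_gens_def by (auto simp: edges_doubleton_iff intro!: edge_polys_sum edge_polys_xvar edge_polys_mult)

lemma swap_gens_subset: "swap_gens n \<subseteq> edge_polys n"
  unfolding swap_gens_def by (auto simp: edges_doubleton_iff intro!: edge_polys_diff edge_polys_xvar edge_polys_mult)

lemma ideal_J: "ideal (J_ideal n) (edge_poly_ring n)"
proof -
  interpret cring "edge_poly_ring n" by (rule cring_edge_poly_ring)
  show ?thesis unfolding J_ideal_def I_ideal_def
    by (intro add_ideals genideal_ideal I_gens_subset swap_gens_subset)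
qed

lemma J_0 [simp, intro]: "0 \<in> J_ideal n"
  using additive_subgroup.zero_closed[OF ideal.axioms(1)[OF ideal_J]] by simp

lemma J_add [intro]: "p \<in> J_ideal n \<Longrightarrow> q \<in> J_ideal n \<Longrightarrow> p + q \<in> J_ideal n"
  using additive_subgroup.a_closed[OF ideal.axioms(1)[OF ideal_J]] by simp

lemma J_mult [intro]: "p \<in> J_ideal n \<Longrightarrow> q \<in> edge_polys n \<Longrightarrow> q * p \<in> J_ideal n"
  using ideal.I_l_closed[OF ideal_J] by simp

lemma J_pm_scale [intro]: "p \<in> J_ideal n \<Longrightarrow> pm_scale c p \<in> J_ideal n"
  using J_mult[of p n "Poly_Mapping.single 0 c"] by (simp add: single_0_mult)

lemma J_uminus [intro]: "p \<in> J_ideal n \<Longrightarrow> - p \<in> J_ideal n"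
  using J_mult[of p n "- 1"] by (simp add: edge_polys_uminus)

lemma J_diff [intro]: "p \<in> J_ideal n \<Longrightarrow> q \<in> J_ideal n \<Longrightarrow> p - q \<in> J_ideal n"
  using J_add[of p n "- q"] by auto

lemma J_subspace: "pm.subspace (J_ideal n)"
  by (intro pm.subspaceI) auto

lemma J_gens: "I_gens n \<subseteq> J_ideal n" "swap_gens n \<subseteq> J_ideal n"
proof -
  interpret cring "edge_poly_ring n" by (rule cring_edge_poly_ring)
  have 1: "I_gens n \<subseteq> Idl\<^bsub>edge_poly_ring n\<^esub> I_gens n"
    "swap_gens n \<subseteq> Idl\<^bsub>edge_poly_ring n\<^esub> swap_gens n"
    using genideal_self I_gens_subset swap_gens_subset by blast+
  have 2: "0 \<in> Idl\<^bsub>edge_poly_ring n\<^esub> I_gens n" "0 \<in> Idl\<^bsub>edge_poly_ring n\<^esub> swap_gens n"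
    using additive_subgroup.zero_closed[OF ideal.axioms(1)[OF genideal_ideal]]
      I_gens_subset swap_gens_subset by fastforce+
  show "I_gens n \<subseteq> J_ideal n"
  proof
    fix x assume "x \<in> I_gens n"
    then have "\<exists>h\<in>Idl\<^bsub>edge_poly_ring n\<^esub> I_gens n. \<exists>k\<in>Idl\<^bsub>edge_poly_ring n\<^esub> swap_gens n. x = h + k"
      using 1 2 by (intro bexI[of _ x] bexI[of _ 0]) auto
    then show "x \<in> J_ideal n" by (auto simp: J_ideal_def I_ideal_def set_add_def')
  qed
  show "swap_gens n \<subseteq> J_ideal n"
  proof
    fix x assume "x \<in> swap_gens n"
    then have "\<exists>h\<in>Idl\<^bsub>edge_poly_ring n\<^esub> I_gens n. \<exists>k\<in>Idl\<^bsub>edge_poly_ring n\<^esub> swap_gens n. x = h + k"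
      using 1 2 by (intro bexI[of _ 0] bexI[of _ x]) auto
    then show "x \<in> J_ideal n" by (auto simp: J_ideal_def I_ideal_def set_add_def')
  qed
qed

text \<open>
  Both summands of the ideal are generated ideals, so membership can be treated as if the ideal were
  generated by all generators together.
\<close>
lemma J_induct [consumes 1, case_names gen add mult]:
  assumes p: "p \<in> J_ideal n"
    and gen: "\<And>g. g \<in> I_gens n \<union> swap_gens n \<Longrightarrow> P g"
    and add: "\<And>p q. p \<in> edge_polys n \<Longrightarrow> q \<in> edge_polys n \<Longrightarrow> P p \<Longrightarrow> P q \<Longrightarrow> P (p + q)"
    and mult: "\<And>p q. p \<in> edge_polys n \<Longrightarrow> q \<in> edge_polys n \<Longrightarrow> P p \<Longrightarrow> P (q * p)"
    and P0: "P 0"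
  shows "P p"
proof -
  interpret cring "edge_poly_ring n" by (rule cring_edge_poly_ring)
  define K where "K = {p \<in> edge_polys n. P p}"
  have inv: "- x \<in> K" if "x \<in> K" for x
    using mult[of x "- 1"] that by (auto simp: K_def edge_polys_uminus)
  have minus: "\<ominus>\<^bsub>edge_poly_ring n\<^esub> x = - x" if "x \<in> edge_polys n" for x
    using that by (intro minus_equality) auto
  have "ideal K (edge_poly_ring n)"
  proof (rule idealI)
    show "ring (edge_poly_ring n)" by (rule ring_axioms)
    show "subgroup K (add_monoid (edge_poly_ring n))"
    proof (rule subgroup.intro)
      fix x assume "x \<in> K"
      then show "inv\<^bsub>add_monoid (edge_poly_ring n)\<^esub> x \<in> K"
        using inv minus[of x] by (auto simp: a_inv_def K_def)
    qed (auto simp: K_def intro: add P0)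
    fix a x assume "a \<in> K" "x \<in> edge_polys n"
    then show "x \<otimes>\<^bsub>edge_poly_ring n\<^esub> a \<in> K" "a \<otimes>\<^bsub>edge_poly_ring n\<^esub> x \<in> K"
      using mult[of a x] by (auto simp: K_def mult.commute)
  qed
  moreover from this have "I_gens n \<subseteq> K" "swap_gens n \<subseteq> K"
    using gen I_gens_subset swap_gens_subset unfolding K_def by blast+
  ultimately have "Idl\<^bsub>edge_poly_ring n\<^esub> I_gens n \<subseteq> K" "Idl\<^bsub>edge_poly_ring n\<^esub> swap_gens n \<subseteq> K"
    by (simp_all add: genideal_minimal)
  then show ?thesis using p add
    by (auto simp: J_ideal_def I_ideal_def set_add_def' K_def subset_iff)
qed

lemma J_prod_intersecting:
  "S \<in> edges n \<Longrightarrow> T \<in> edges n \<Longrightarrow> S \<inter> T \<noteq> {} \<Longrightarrow> xvar S * xvar T \<in> J_ideal n"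
  using J_gens(1)[of n] unfolding I_gens_def by blast

lemma J_star: "i \<in> {1..n} \<Longrightarrow> (\<Sum>j\<in>{1..n} - {i}. xvar {i, j}) \<in> J_ideal n"
  using J_gens(1)[of n] unfolding I_gens_def by blast

lemma J_swap: "{i, j, k, l} \<subseteq> {1..n} \<Longrightarrow> distinct [i, j, k, l] \<Longrightarrow>
    xvar {i, j} * xvar {k, l} - xvar {i, k} * xvar {j, l} \<in> J_ideal n"
  using J_gens(2)[of n] unfolding swap_gens_def by blast

section \<open>Matchings\<close>

definition matching :: "nat \<Rightarrow> nat set set \<Rightarrow> bool" where
  "matching n P \<longleftrightarrow> P \<subseteq> edges n \<and> pairwise disjnt P"

definition matching_mono :: "nat set set \<Rightarrow> mono" where
  "matching_mono P = (\<Sum>S\<in>P. Poly_Mapping.single S 1)"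

definition matching_poly :: "nat set set \<Rightarrow> mpoly" where
  "matching_poly P = (\<Prod>S\<in>P. xvar S)"

lemma finite_edges [simp]: "finite (edges n)"
  unfolding edges_def by (rule finite_subset[of _ "Pow {1..n}"]) auto

lemma matching_finite: "matching n P \<Longrightarrow> finite P"
  unfolding matching_def using finite_subset finite_edges by blast

lemma matching_Union: "matching n P \<Longrightarrow> \<Union>P \<subseteq> {1..n}"
  unfolding matching_def edges_def by blast

lemma card_matching_Union: "matching n P \<Longrightarrow> card (\<Union>P) = 2 * card P"
proof -
  assume P: "matching n P"
  then have "finite S \<and> card S = 2" if "S \<in> P" for S
    using that finite_subset[of S "{1..n}"] by (auto simp: matching_def edges_def)
  moreover from this have "sum card P = (\<Sum>S\<in>P. 2)" by (intro sum.cong) auto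
  ultimately show ?thesis using P by (subst card_Union_disjoint) (auto simp: matching_def)
qed

lemma matching_subset: "matching n P \<Longrightarrow> Q \<subseteq> P \<Longrightarrow> matching n Q"
  unfolding matching_def using pairwise_subset by blast

lemma matching_insert:
  "matching n (insert S P) \<longleftrightarrow> S \<in> edges n \<and> matching n P \<and> (\<forall>T\<in>P. S \<noteq> T \<longrightarrow> disjnt S T)"
  unfolding matching_def by (auto simp: pairwise_insert disjnt_sym)

lemma lookup_matching_mono:
  "finite P \<Longrightarrow> Poly_Mapping.lookup (matching_mono P) S = (if S \<in> P then 1 else 0)"
  by (simp add: matching_mono_def lookup_sum lookup_single when_def)

lemma keys_matching_mono: "finite P \<Longrightarrow> Poly_Mapping.keys (matching_mono P) = P"
  by (auto simp: in_keys_iff lookup_matching_mono split: if_splits)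

lemma matching_poly_eq: "finite P \<Longrightarrow> matching_poly P = Poly_Mapping.single (matching_mono P) 1"
  unfolding matching_poly_def matching_mono_def
  by (induction P rule: finite_induct) (simp_all add: xvar_def mult_single)

lemma edge_polys_matching_poly: "matching n P \<Longrightarrow> matching_poly P \<in> edge_polys n"
  unfolding matching_poly_def matching_def by (intro edge_polys_prod edge_polys_xvar) auto

lemma matching_poly_remove:
  "finite P \<Longrightarrow> S \<in> P \<Longrightarrow> matching_poly P = xvar S * matching_poly (P - {S})"
  unfolding matching_poly_def by (rule prod.remove)

subsection \<open>Functionals that vanish on the ideal\<close>

text \<open>
  The exponents and the disjointness of the keys say that \<open>m\<close> is the monomial of a matching with \<open>d\<close>
  edges.  Its value depends only on the set that the matching covers; all other monomials get the
  value zero.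
\<close>
definition matching_value :: "nat \<Rightarrow> (nat set \<Rightarrow> complex) \<Rightarrow> mono \<Rightarrow> complex" where
  "matching_value d v m = (if (\<forall>S. Poly_Mapping.lookup m S \<le> 1) \<and>
      pairwise disjnt (Poly_Mapping.keys m) \<and> card (Poly_Mapping.keys m) = d
    then v (\<Union>(Poly_Mapping.keys m)) else 0)"

abbreviation matching_functional :: "nat \<Rightarrow> (nat set \<Rightarrow> complex) \<Rightarrow> mpoly \<Rightarrow> complex" where
  "matching_functional d v \<equiv> lin_ext (*) (matching_value d v)"

lemma keys_single_add:
  "Poly_Mapping.keys (Poly_Mapping.single S (1::nat) + m) = insert S (Poly_Mapping.keys m)"
  by (auto simp: in_keys_iff lookup_add lookup_single when_def split: if_splits)

lemma matching_value_0: "matching_value 0 v (Poly_Mapping.single S 1 + m) = 0"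
  by (simp add: matching_value_def keys_single_add del: One_nat_def)

lemma matching_value_Suc:
  assumes "S \<noteq> {}"
  shows "matching_value (Suc d) v (Poly_Mapping.single S 1 + m) =
    (if disjnt S (\<Union>(Poly_Mapping.keys m)) then matching_value d (\<lambda>T. v (S \<union> T)) m else 0)"
proof (cases "S \<in> Poly_Mapping.keys m")
  case True
  then have "\<not> Poly_Mapping.lookup (Poly_Mapping.single S 1 + m) S \<le> 1"
    by (simp add: lookup_add in_keys_iff)
  moreover have "\<not> disjnt S (\<Union>(Poly_Mapping.keys m))"
    using True assms by (auto simp: disjnt_def)
  ultimately show ?thesis unfolding matching_value_def by auto
next
  case False
  then have [simp]: "Poly_Mapping.lookup m S = 0" by (simp add: in_keys_iff)
  have "(\<forall>T. Poly_Mapping.lookup (Poly_Mapping.single S 1 + m) T \<le> 1) \<longleftrightarrow>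
      (\<forall>T. Poly_Mapping.lookup m T \<le> 1)"
    by (auto simp: lookup_add lookup_single when_def)
  moreover have "pairwise disjnt (insert S (Poly_Mapping.keys m)) \<longleftrightarrow>
      pairwise disjnt (Poly_Mapping.keys m) \<and> disjnt S (\<Union>(Poly_Mapping.keys m))"
    using False by (auto simp: pairwise_insert disjnt_def)
  moreover have "card (insert S (Poly_Mapping.keys m)) = Suc (card (Poly_Mapping.keys m))"
    using False by simp
  ultimately show ?thesis
    by (simp add: matching_value_def keys_single_add del: One_nat_def)
qed

lemma matching_value_Suc_Suc:
  assumes "S \<noteq> {}" "T \<noteq> {}"
  shows "matching_value d v (Poly_Mapping.single S 1 + (Poly_Mapping.single T 1 + m)) =
    (if d \<ge> 2 \<and> disjnt S T \<and> disjnt (S \<union> T) (\<Union>(Poly_Mapping.keys m))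
     then matching_value (d - 2) (\<lambda>Y. v (S \<union> T \<union> Y)) m else 0)"
proof -
  consider "d = 0" | "d = Suc 0" | e where "d = Suc (Suc e)"
    by (cases d; cases "d - 1") auto
  then show ?thesis
  proof cases
    case 1
    then show ?thesis by (simp only: matching_value_0) simp
  next
    case 2
    then show ?thesis by (simp only: matching_value_Suc[OF assms(1)] matching_value_0) simp
  next
    case 3
    have "disjnt S (\<Union>(Poly_Mapping.keys (Poly_Mapping.single T 1 + m))) \<longleftrightarrow>
        disjnt S T \<and> disjnt S (\<Union>(Poly_Mapping.keys m))"
      by (auto simp: keys_single_add disjnt_def simp del: One_nat_def)
    then show ?thesis
      unfolding 3 matching_value_Suc[OF assms(1)] matching_value_Suc[OF assms(2)]
      by (simp add: Un_assoc disjnt_Un1)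
  qed
qed

lemma matching_functional_matching_poly:
  assumes "matching n P"
  shows "matching_functional (card P) v (matching_poly P) = v (\<Union>P)"
  using assms matching_finite[OF assms]
  by (simp add: matching_poly_eq fun_ext_simps matching_value_def lookup_matching_mono
      keys_matching_mono matching_def)

text \<open>
  A product of intersecting variables divides no monomial of a matching.  The two products of a swap
  generator cover the same four points, hence have equal values.  For a linear generator at \<open>i\<close>
  times a matching that covers \<open>U\<close>, the terms with \<open>j \<in> U\<close> have value zero; the remaining ones give
  the sum in \<open>up\<close> for the set \<open>insert i U\<close>.
\<close>
lemma matching_functional_generator:
  assumes up: "\<And>W. W \<subseteq> {1..n} \<Longrightarrow> Suc (card W) = 2 * d \<Longrightarrow> (\<Sum>c\<in>{1..n} - W. v (insert c W)) = 0"
    and g: "g \<in> I_gens n \<union> swap_gens n" and m: "Poly_Mapping.keys m \<subseteq> edges n"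
  shows "matching_functional d v (Poly_Mapping.single m a * g) = 0"
proof -
  define U where "U = \<Union>(Poly_Mapping.keys m)"
  have term1: "Poly_Mapping.single m a * xvar S =
      Poly_Mapping.single (Poly_Mapping.single S 1 + m) a" for S m
    by (simp add: xvar_def mult_single add.commute)
  have term2: "Poly_Mapping.single m a * (xvar S * xvar T) =
      Poly_Mapping.single (Poly_Mapping.single S 1 + (Poly_Mapping.single T 1 + m)) a" for S T
    by (subst mult.commute[of "xvar S"], subst mult.assoc[symmetric]) (simp only: term1)
  from g consider
    (star) i where "i \<in> {1..n}" "g = (\<Sum>j\<in>{1..n} - {i}. xvar {i, j})"
    | (meet) S T where "S \<inter> T \<noteq> {}" "g = xvar S * xvar T"
    | (swap) i j k l where "distinct [i, j, k, l]"
        "g = xvar {i, j} * xvar {k, l} - xvar {i, k} * xvar {j, l}"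
    unfolding I_gens_def swap_gens_def by (elim UnE CollectE exE conjE)
  then show ?thesis
  proof cases
    case star
    have L: "matching_functional d v (Poly_Mapping.single m a * g) =
        a * (\<Sum>j\<in>{1..n} - {i}. matching_value d v (Poly_Mapping.single {i, j} 1 + m))"
      by (simp add: star sum_distrib_left term1 fun_ext_simps del: One_nat_def)
    show ?thesis
    proof (cases d)
      case 0
      then show ?thesis unfolding L by (simp only: matching_value_0) simp
    next
      case (Suc e)
      have V: "matching_value d v (Poly_Mapping.single {i, j} 1 + m) =
          (if disjnt {i, j} U then matching_value e (\<lambda>T. v ({i, j} \<union> T)) m else 0)" for j
        unfolding Suc U_def by (rule matching_value_Suc) simp
      show ?thesis
      proof (cases "i \<notin> U \<and> pairwise disjnt (Poly_Mapping.keys m) \<and> card (Poly_Mapping.keys m) = e")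
        case True
        then have "card U = 2 * e" and U: "U \<subseteq> {1..n}"
          using card_matching_Union[of n "Poly_Mapping.keys m"] matching_Union[of n "Poly_Mapping.keys m"] m
          by (auto simp: U_def matching_def)
        moreover have "finite U" using U finite_subset by blast
        ultimately have card: "Suc (card (insert i U)) = 2 * d" using True Suc by simp
        \<comment> \<open>The factor \<open>b\<close> covers the case that \<open>m\<close> is not squarefree, where all terms are zero.\<close>
        define b where "b = (if \<forall>S. Poly_Mapping.lookup m S \<le> 1 then 1 else 0 :: complex)"
        have "(\<Sum>j\<in>{1..n} - {i}. matching_value d v (Poly_Mapping.single {i, j} 1 + m)) =
            (\<Sum>j\<in>{1..n} - insert i U. b * v (insert j (insert i U)))"
        proof (rule sum.mono_neutral_cong_right)
          fix j assume "j \<in> {1..n} - insert i U"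
          then show "matching_value d v (Poly_Mapping.single {i, j} 1 + m) = b * v (insert j (insert i U))"
            using True unfolding V
            by (simp add: matching_value_def U_def[symmetric] b_def disjnt_def insert_commute)
        qed (auto simp: V disjnt_def simp del: One_nat_def)
        also have "\<dots> = b * (\<Sum>j\<in>{1..n} - insert i U. v (insert j (insert i U)))"
          by (simp add: sum_distrib_left)
        also have "\<dots> = 0"
          using up[of "insert i U"] U card star by simp
        finally show ?thesis by (simp add: L)
      next
        case False
        then have "matching_value d v (Poly_Mapping.single {i, j} 1 + m) = 0" for j
          unfolding V by (auto simp: matching_value_def disjnt_def simp del: One_nat_def)
        then show ?thesis by (simp add: L)
      qed
    qed
  next
    case meet
    then have "matching_value d v (Poly_Mapping.single S 1 + (Poly_Mapping.single T 1 + m)) = 0"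
      by (subst matching_value_Suc_Suc) (auto simp: disjnt_def)
    then show ?thesis by (simp only: meet term2 fun_ext_simps) simp
  next
    case swap
    have "matching_value d v (Poly_Mapping.single {i, j} 1 + (Poly_Mapping.single {k, l} 1 + m)) =
        matching_value d v (Poly_Mapping.single {i, k} 1 + (Poly_Mapping.single {j, l} 1 + m))"
    proof -
      have "disjnt {i, j} {k, l}" "disjnt {i, k} {j, l}" "{i, j} \<union> {k, l} = {i, k} \<union> {j, l}"
        using swap(1) by (auto simp: disjnt_def)
      then show ?thesis by (simp only: matching_value_Suc_Suc[OF insert_not_empty insert_not_empty])
    qed
    then show ?thesis by (simp only: swap right_diff_distrib term2 fun_ext_simps) simp
  qed
qed

text \<open>
  The kernel of the functional is not closed under multiplication by itself, so the induction over
  the ideal shows that the functional vanishes on all multiples of \<open>p\<close>.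
\<close>
lemma matching_functional_vanishes:
  assumes up: "\<And>W. W \<subseteq> {1..n} \<Longrightarrow> Suc (card W) = 2 * d \<Longrightarrow> (\<Sum>c\<in>{1..n} - W. v (insert c W)) = 0"
    and p: "p \<in> J_ideal n"
  shows "matching_functional d v p = 0"
proof -
  have "\<forall>q\<in>edge_polys n. matching_functional d v (q * p) = 0"
    using p
  proof (induction p rule: J_induct)
    case (gen g)
    show ?case
    proof
      fix q assume q: "q \<in> edge_polys n"
      have "q * g = (\<Sum>m\<in>Poly_Mapping.keys q. Poly_Mapping.single m (Poly_Mapping.lookup q m) * g)"
        by (simp add: sum_singles flip: sum_distrib_right)
      then show "matching_functional d v (q * g) = 0"
        using matching_functional_generator[OF up gen] q
        by (simp add: fun_ext_simps mem_edge_polys)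
    qed
  next
    case (mult p r)
    then show ?case by (auto simp: edge_polys_mult simp flip: mult.assoc)
  qed (simp_all add: distrib_left fun_ext_simps)
  from bspec[OF this edge_polys_1] show ?thesis by simp
qed

subsection \<open>Matchings with the same support are congruent\<close>

lemma doubleton_partner:
  assumes "S \<in> edges n" "i \<in> S"
  obtains j where "S = {i, j}" "j \<noteq> i"
  using assms by (auto simp: edges_def card_2_iff)

lemma matching_poly_cong_common_edge:
  assumes "matching n P" "matching n Q" "S \<in> P" "S \<in> Q"
    and "matching_poly (P - {S}) - matching_poly (Q - {S}) \<in> J_ideal n"
  shows "matching_poly P - matching_poly Q \<in> J_ideal n"
proof -
  have "matching_poly P - matching_poly Q =
      xvar S * (matching_poly (P - {S}) - matching_poly (Q - {S}))"
    using assms matching_finite by (simp add: matching_poly_remove[of _ S] right_diff_distrib)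
  moreover have "xvar S \<in> edge_polys n" using assms unfolding matching_def by blast
  ultimately show ?thesis using assms(5) by auto
qed

lemma matching_Union_remove:
  "matching n P \<Longrightarrow> S \<in> P \<Longrightarrow> \<Union>(P - {S}) = \<Union>P - S"
  unfolding matching_def pairwise_def disjnt_def by blast

lemma matching_swap:
  assumes "matching n Q" "{i, k} \<in> Q" "{j, l} \<in> Q" "distinct [i, j, k, l]"
  defines "R \<equiv> Q - {{i, k}, {j, l}}"
  shows "matching n (insert {i, j} (insert {k, l} R))"
    and "\<Union>(insert {i, j} (insert {k, l} R)) = \<Union>Q"
    and "matching_poly Q - matching_poly (insert {i, j} (insert {k, l} R)) \<in> J_ideal n"
proof -
  have dj: "S \<inter> {i, j, k, l} = {}" if "S \<in> R" for S
  proof -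
    have pw: "pairwise disjnt Q" using assms(1) by (simp add: matching_def)
    have S: "S \<in> Q" "S \<noteq> {i, k}" "S \<noteq> {j, l}" using that by (simp_all add: R_def)
    have "disjnt S {i, k}" "disjnt S {j, l}"
      by (rule pairwiseD[OF pw S(1)]; use S assms(2,3) in blast)+
    then show ?thesis by (auto simp: disjnt_def)
  qed
  have R: "matching n R" "finite R"
    using assms(1) matching_subset[of n Q R] matching_finite by (auto simp: R_def)
  have in_n: "{i, j, k, l} \<subseteq> {1..n}" using matching_Union[OF assms(1)] assms(2,3) by blast
  show "matching n (insert {i, j} (insert {k, l} R))"
    using R dj in_n assms(4) by (auto simp: matching_insert edges_doubleton_iff disjnt_def)
  show "\<Union>(insert {i, j} (insert {k, l} R)) = \<Union>Q"
    using assms(2,3) unfolding R_def by auto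
  have Q: "Q = insert {i, k} (insert {j, l} R)" using assms(2,3) unfolding R_def by auto
  have new: "{i, k} \<notin> insert {j, l} R" "{j, l} \<notin> R" "{i, j} \<notin> insert {k, l} R" "{k, l} \<notin> R"
    using dj assms(4) by (auto simp: doubleton_eq_iff)
  have "matching_poly Q = xvar {i, k} * (xvar {j, l} * matching_poly R)"
    unfolding Q matching_poly_def using new R by simp
  moreover have "matching_poly (insert {i, j} (insert {k, l} R)) =
      xvar {i, j} * (xvar {k, l} * matching_poly R)"
    unfolding matching_poly_def using new R by simp
  ultimately have "matching_poly Q - matching_poly (insert {i, j} (insert {k, l} R)) =
      matching_poly R * (xvar {i, k} * xvar {j, l} - xvar {i, j} * xvar {k, l})"
    by (simp add: algebra_simps)
  moreover have "xvar {i, k} * xvar {j, l} - xvar {i, j} * xvar {k, l} \<in> J_ideal n"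
    using J_swap[of i k j l] in_n assms(4) by auto
  ultimately show "matching_poly Q - matching_poly (insert {i, j} (insert {k, l} R)) \<in> J_ideal n"
    using edge_polys_matching_poly[OF R(1)] by auto
qed

text \<open>
  Induction on the number of edges.  If an edge \<open>{i, j}\<close> of \<open>P\<close> is not in \<open>Q\<close>, then \<open>Q\<close> has
  edges \<open>{i, k}\<close> and \<open>{j, l}\<close>; a swap turns them into \<open>{i, j}\<close> and \<open>{k, l}\<close>.  Now \<open>P\<close> and \<open>Q\<close> have
  a common edge, which can be removed from both.
\<close>
lemma matching_poly_cong:
  assumes "matching n P" "matching n Q" "\<Union>P = \<Union>Q"
  shows "matching_poly P - matching_poly Q \<in> J_ideal n"
  using assms
proof (induction "card P" arbitrary: P Q)
  case 0
  then have "P = {}" using matching_finite by simp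
  moreover have "Q = {}"
    using 0 card_matching_Union[of n Q] matching_finite[of n Q] \<open>P = {}\<close> by (metis
      Union_empty card.empty card_eq_0_iff mult_eq_0_iff zero_neq_numeral)
  ultimately show ?case by simp
next
  case (Suc c)
  then obtain S where S: "S \<in> P" by fastforce
  have common: "matching_poly P - matching_poly Q \<in> J_ideal n"
    if Q: "matching n Q" "\<Union>P = \<Union>Q" "S \<in> Q" for Q
  proof (rule matching_poly_cong_common_edge)
    show "matching_poly (P - {S}) - matching_poly (Q - {S}) \<in> J_ideal n"
      using Suc S Q matching_finite
      by (intro Suc.hyps) (auto simp: matching_Union_remove intro: matching_subset)
  qed (use Suc S Q in auto)
  show ?case
  proof (cases "S \<in> Q")
    case True
    then show ?thesis using common Suc.prems by simp
  next
    case False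
    obtain i j where ij: "S = {i, j}" "i \<noteq> j" and "S \<subseteq> {1..n}"
      using S Suc.prems(1) by (auto simp: matching_def edges_def card_2_iff)
    obtain A where A: "A \<in> Q" "i \<in> A" using S ij Suc.prems by blast
    obtain B where B: "B \<in> Q" "j \<in> B" using S ij Suc.prems by blast
    obtain k where k: "A = {i, k}" "k \<noteq> i"
      using A Suc.prems(2) doubleton_partner[of A n i] unfolding matching_def by blast
    obtain l where l: "B = {j, l}" "l \<noteq> j"
      using B Suc.prems(2) doubleton_partner[of B n j] unfolding matching_def by blast
    have "A \<noteq> B" using k l ij A B False by auto
    then have "disjnt A B" using A B Suc.prems by (auto simp: matching_def pairwise_def)
    then have "distinct [i, j, k, l]" using k l ij by (auto simp: disjnt_def)
    note sw = matching_swap[OF Suc.prems(2) A(1)[unfolded k] B(1)[unfolded l] this]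
    have "matching_poly P -
        matching_poly (insert {i, j} (insert {k, l} (Q - {{i, k}, {j, l}}))) \<in> J_ideal n"
      using sw(1,2) Suc.prems(3) ij by (intro common) auto
    from J_diff[OF this sw(3)] show ?thesis by simp
  qed
qed

section \<open>Polytabloids of two-row shape\<close>

text \<open>
  Partitions have no zero parts, hence the case \<open>k = 0\<close> is a single row.
\<close>
definition two_row :: "nat \<Rightarrow> nat \<Rightarrow> nat list" where
  "two_row n k = (n - k) # (if k = 0 then [] else [k])"

text \<open>
  The tabloid with second row \<open>T\<close>; it has only one row if \<open>T\<close> is empty, in accordance with
  \<open>two_row\<close>.
\<close>
definition row_tabloid :: "nat \<Rightarrow> nat set \<Rightarrow> nat set list" where
  "row_tabloid n T = ({1..n} - T) # (if T = {} then [] else [T])"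

definition second_row :: "nat set list \<Rightarrow> nat set" where
  "second_row \<tau> = (if length \<tau> > 1 then \<tau> ! 1 else {})"

abbreviation tabloid_vec :: "nat \<Rightarrow> nat set \<Rightarrow> (nat set list \<Rightarrow>\<^sub>0 complex)" where
  "tabloid_vec n T \<equiv> Poly_Mapping.single (row_tabloid n T) 1"

lemma second_row_tabloid [simp]: "second_row (row_tabloid n T) = T"
  by (simp add: second_row_def row_tabloid_def)

lemma young_two_row: "young (two_row n k) = {0} \<times> {..<n - k} \<union> {1} \<times> {..<k}"
  by (auto simp: young_def two_row_def nth_Cons split: nat.splits if_splits)

lemma tableau_rows:
  assumes "tableau n (two_row n k) t"
  shows "(\<lambda>j. t (0, j)) ` {..<n - k} = {1..n} - (\<lambda>j. t (1, j)) ` {..<k}"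
proof -
  have bij: "bij_betw t ({0} \<times> {..<n - k} \<union> {1} \<times> {..<k}) {1..n}"
    using assms unfolding tableau_def young_two_row .
  have "t ` ({0} \<times> {..<n - k}) \<inter> t ` ({1} \<times> {..<k}) = {}"
    using bij by (intro inj_on_image_Int[OF bij_betw_imp_inj_on[OF bij], symmetric, THEN trans]) auto
  moreover have "t ` ({0} \<times> {..<n - k}) \<union> t ` ({1} \<times> {..<k}) = {1..n}"
    using bij_betw_imp_surj_on[OF bij] by (simp add: image_Un)
  moreover have "t ` ({i} \<times> A) = (\<lambda>j. t (i, j)) ` A" for i A by auto
  ultimately show ?thesis by auto
qed

lemma tabloid_two_row:
  assumes "tableau n (two_row n k) t"
  shows "tabloid (two_row n k) t = row_tabloid n ((\<lambda>j. t (1, j)) ` {..<k})"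
  using tableau_rows[OF assms]
  by (cases "k = 0") (auto simp: tabloid_def two_row_def row_tabloid_def lessThan_empty_iff)

definition pair_stabilizer :: "(nat \<times> nat) list \<Rightarrow> (nat \<Rightarrow> nat) set" where
  "pair_stabilizer ps = {p. p permutes set (ends ps) \<and>
     (\<forall>(a, b)\<in>set ps. p a \<in> {a, b} \<and> p b \<in> {a, b})}"

lemma finite_pair_stabilizer: "finite (pair_stabilizer ps)"
  unfolding pair_stabilizer_def
  by (rule finite_subset[OF _ finite_permutations[of "set (ends ps)"]]) auto

lemma pair_mem_ends: "(a, b) \<in> set ps \<Longrightarrow> a \<in> set (ends ps) \<and> b \<in> set (ends ps)"
  by (force simp: ends_def)

text \<open>
  A permutation that preserves the pair \<open>{a, b}\<close> fixes or exchanges its entries; in the second case,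
  composing with the transposition leads back to the first.
\<close>
lemma pair_stabilizer_Cons:
  assumes "distinct (ends ((a, b) # ps))"
  shows "pair_stabilizer ((a, b) # ps) =
    pair_stabilizer ps \<union> (\<lambda>p. Transposition.transpose a b \<circ> p) ` pair_stabilizer ps" (is "?L = ?R")
proof -
  let ?t = "Transposition.transpose a b"
  have ab: "a \<noteq> b" "a \<notin> set (ends ps)" "b \<notin> set (ends ps)" using assms by auto
  have fix_ab: "p a = a" "p b = b" if "p \<in> pair_stabilizer ps" for p
    using that ab by (auto simp: pair_stabilizer_def permutes_not_in)
  have t_fix: "?t c = c" if "c \<in> set (ends ps)" for c
    using that ab by (auto simp: Transposition.transpose_def)
  have t_stab: "?t \<circ> p \<in> ?L" if p: "p \<in> pair_stabilizer ps" for p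
  proof -
    have "p permutes set (ends ((a, b) # ps))"
      using p by (auto simp: pair_stabilizer_def intro: permutes_subset)
    then have "?t \<circ> p permutes set (ends ((a, b) # ps))"
      by (intro permutes_compose permutes_swap_id) auto
    moreover have "(?t \<circ> p) c \<in> {c, d} \<and> (?t \<circ> p) d \<in> {c, d}" if "(c, d) \<in> set ps" for c d
      using p that t_fix pair_mem_ends[OF that] by (fastforce simp: pair_stabilizer_def)
    ultimately show ?thesis
      using fix_ab[OF p] by (auto simp: pair_stabilizer_def)
  qed
  have stab: "p \<in> ?L" if p: "p \<in> pair_stabilizer ps" for p
    using p fix_ab[OF p] by (auto simp: pair_stabilizer_def intro: permutes_subset)
  have fixed: "p \<in> pair_stabilizer ps" if p: "p \<in> ?L" and pa: "p a = a" for p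
  proof -
    have perm: "p permutes set (ends ((a, b) # ps))" using p by (simp add: pair_stabilizer_def)
    have "p b \<noteq> p a" using permutes_inj[OF perm] ab by (auto dest: injD)
    then have "p b = b" using p pa by (auto simp: pair_stabilizer_def)
    then have "p permutes set (ends ps)"
      using pa by (intro permutes_superset[OF perm]) auto
    then show ?thesis using p by (auto simp: pair_stabilizer_def)
  qed
  have moved: "p \<in> ?R" if p: "p \<in> ?L" and pa: "p a = b" for p
  proof -
    have perm: "p permutes set (ends ((a, b) # ps))" using p by (simp add: pair_stabilizer_def)
    have "p b \<noteq> p a" using permutes_inj[OF perm] ab by (auto dest: injD)
    then have pb: "p b = a" using p pa by (auto simp: pair_stabilizer_def)
    have "?t \<circ> p permutes set (ends ((a, b) # ps))"
      using perm by (intro permutes_compose permutes_swap_id) auto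
    moreover have "(?t \<circ> p) c \<in> {c, d} \<and> (?t \<circ> p) d \<in> {c, d}" if "(c, d) \<in> set ps" for c d
      using p that t_fix pair_mem_ends[OF that] by (fastforce simp: pair_stabilizer_def)
    ultimately have "?t \<circ> p \<in> ?L" using pa pb by (auto simp: pair_stabilizer_def)
    then have "?t \<circ> p \<in> pair_stabilizer ps" using pa by (intro fixed) auto
    moreover have "p = ?t \<circ> (?t \<circ> p)" by (simp add: fun_eq_iff)
    ultimately show ?thesis by blast
  qed
  show ?thesis
  proof
    show "?L \<subseteq> ?R"
    proof
      fix p assume p: "p \<in> ?L"
      then have "p a = a \<or> p a = b" by (auto simp: pair_stabilizer_def)
      then show "p \<in> ?R" using fixed[OF p] moved[OF p] by blast
    qed
  qed (use t_stab stab in auto)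
qed

text \<open>
  The two halves of the stabilizer give the two terms in the recursion of \<open>alt\<close>, the minus sign
  being the sign of the transposition.
\<close>
lemma sum_pair_stabilizer:
  fixes \<phi> :: "nat set \<Rightarrow> ('k \<Rightarrow>\<^sub>0 complex)"
  assumes "distinct (ends ps)"
  shows "(\<Sum>p\<in>pair_stabilizer ps. pm_scale (of_int (sign p)) (\<phi> (p ` fst ` set ps \<union> F))) = alt ps F \<phi>"
  using assms
proof (induction ps arbitrary: F)
  case Nil
  have "pair_stabilizer [] = {id}" by (simp add: pair_stabilizer_def)
  then show ?case by simp
next
  case (Cons q ps)
  obtain a b where q: "q = (a, b)" by fastforce
  let ?t = "Transposition.transpose a b"
  let ?S = "pair_stabilizer ps"
  have ab: "a \<noteq> b" "a \<notin> set (ends ps)" "b \<notin> set (ends ps)" using Cons.prems by (auto simp: q)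
  have perm: "p permutes set (ends ps)" if "p \<in> ?S" for p
    using that by (simp add: pair_stabilizer_def)
  have fix_ab: "p a = a" "p b = b" if "p \<in> ?S" for p
    using perm[OF that] ab by (auto simp: permutes_not_in)
  have sub: "fst ` set ps \<subseteq> set (ends ps)" by (auto simp: ends_def)
  have inj: "inj_on (\<lambda>p. ?t \<circ> p) ?S"
    by (intro inj_onI) (metis comp_assoc transpose_comp_involutory id_comp)
  have disj: "?S \<inter> (\<lambda>p. ?t \<circ> p) ` ?S = {}"
  proof -
    have "(?t \<circ> p) a \<noteq> a" if "p \<in> ?S" for p using fix_ab[OF that] ab by simp
    with fix_ab(1) show ?thesis by blast
  qed
  have sg: "sign (?t \<circ> p) = - sign p" if "p \<in> ?S" for p
    using permutes_imp_permutation[OF _ perm[OF that]] ab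
    by (subst sign_compose) (auto simp: sign_swap_id permutation_swap_id)
  have im1: "p ` fst ` set (q # ps) \<union> F = p ` fst ` set ps \<union> insert a F" if "p \<in> ?S" for p
    using fix_ab[OF that] by (simp add: q)
  have im2: "(?t \<circ> p) ` fst ` set (q # ps) \<union> F = p ` fst ` set ps \<union> insert b F" if "p \<in> ?S" for p
  proof -
    have "p ` fst ` set ps \<subseteq> set (ends ps)"
      using permutes_image[OF perm[OF that]] sub by blast
    then have "?t ` p ` fst ` set ps = (\<lambda>x. x) ` p ` fst ` set ps"
      using ab by (intro image_cong) (auto simp: Transposition.transpose_def)
    then show ?thesis using fix_ab[OF that] by (simp add: q image_image)
  qed
  have "(\<Sum>p\<in>pair_stabilizer (q # ps). pm_scale (of_int (sign p)) (\<phi> (p ` fst ` set (q # ps) \<union> F))) =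
      (\<Sum>p\<in>?S. pm_scale (of_int (sign p)) (\<phi> (p ` fst ` set (q # ps) \<union> F))) +
      (\<Sum>p\<in>?S. pm_scale (of_int (sign (?t \<circ> p))) (\<phi> ((?t \<circ> p) ` fst ` set (q # ps) \<union> F)))"
    unfolding q pair_stabilizer_Cons[OF Cons.prems[unfolded q]]
    using finite_pair_stabilizer disj by (subst sum.union_disjoint) (auto simp: sum.reindex[OF inj])
  also have "\<dots> = alt ps (insert a F) \<phi> - alt ps (insert b F) \<phi>"
  proof -
    have dist: "distinct (ends ps)" using Cons.prems by (simp add: q)
    have "(\<Sum>p\<in>?S. pm_scale (of_int (sign p)) (\<phi> (p ` fst ` set (q # ps) \<union> F))) =
        alt ps (insert a F) \<phi>"
      unfolding Cons.IH[OF dist, symmetric] by (intro sum.cong refl) (simp only: im1)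
    moreover have "(\<Sum>p\<in>?S. pm_scale (of_int (sign (?t \<circ> p)))
        (\<phi> ((?t \<circ> p) ` fst ` set (q # ps) \<union> F))) = - alt ps (insert b F) \<phi>"
      unfolding Cons.IH[OF dist, symmetric] sum_negf[symmetric]
      by (intro sum.cong refl) (simp only: im2 sg of_int_minus pm.scale_minus_left)
    ultimately show ?thesis by simp
  qed
  finally show ?case by (simp add: q)
qed

text \<open>
  The entry in the second row comes first, since the identity permutation contributes the second row
  of the tableau with a positive sign.
\<close>
definition tableau_pairs :: "nat \<Rightarrow> (nat \<times> nat \<Rightarrow> nat) \<Rightarrow> (nat \<times> nat) list" where
  "tableau_pairs k t = map (\<lambda>j. (t (1, j), t (0, j))) [0..<k]"

lemma set_ends_tableau_pairs:
  "set (ends (tableau_pairs k t)) = t ` ({0, 1} \<times> {..<k})"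
  by (auto simp: tableau_pairs_def ends_def image_iff)

lemma fst_tableau_pairs: "fst ` set (tableau_pairs k t) = (\<lambda>j. t (1, j)) ` {..<k}"
  by (simp add: tableau_pairs_def image_image lessThan_atLeast0)

lemma tableau_pairs_mem:
  assumes "2 * k \<le> n" "tableau n (two_row n k) t"
  shows "tableau_pairs k t \<in> pair_lists n k"
proof -
  have bij: "bij_betw t ({0} \<times> {..<n - k} \<union> {1} \<times> {..<k}) {1..n}"
    using assms unfolding tableau_def young_two_row by simp
  have sub: "{0, 1} \<times> {..<k} \<subseteq> {0} \<times> {..<n - k} \<union> {1} \<times> {..<k}" using assms(1) by auto
  have inj: "inj_on t ({0, 1} \<times> {..<k})"
    using inj_on_subset[OF bij_betw_imp_inj_on[OF bij] sub] .
  have "distinct (ends (tableau_pairs k t))"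
    by (intro card_distinct, subst set_ends_tableau_pairs, subst card_image[OF inj])
      (simp add: card_cartesian_product tableau_pairs_def)
  moreover have "set (ends (tableau_pairs k t)) \<subseteq> {1..n}"
    unfolding set_ends_tableau_pairs using sub bij_betw_imp_surj_on[OF bij] by blast
  ultimately show ?thesis by (simp add: pair_lists_def tableau_pairs_def)
qed

text \<open>
  The columns \<open>j < k\<close> are the pairs, and the columns \<open>k \<le> j < n - k\<close> are single points, which must
  be fixed.
\<close>
lemma column_stabilizer_two_row:
  assumes k: "2 * k \<le> n" and t: "tableau n (two_row n k) t"
  shows "column_stabilizer n (two_row n k) t = pair_stabilizer (tableau_pairs k t)"
proof -
  have bij: "bij_betw t ({0} \<times> {..<n - k} \<union> {1} \<times> {..<k}) {1..n}"
    using t unfolding tableau_def young_two_row .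
  let ?E = "set (ends (tableau_pairs k t))"
  have E: "?E \<subseteq> {1..n}" using tableau_pairs_mem[OF assms] by (simp add: pair_lists_def)
  have long: "t (0, j) \<notin> ?E" if "k \<le> j" "j < n - k" for j
  proof
    assume "t (0, j) \<in> ?E"
    then obtain i' j' where ij: "(i', j') \<in> {0, 1} \<times> {..<k}" "t (0, j) = t (i', j')"
      unfolding set_ends_tableau_pairs by auto
    then have "(0, j) = (i', j')"
      using that k by (intro inj_onD[OF bij_betw_imp_inj_on[OF bij]]) auto
    then show False using ij that by simp
  qed
  have outside: "\<exists>j. k \<le> j \<and> j < n - k \<and> x = t (0, j)" if "x \<in> {1..n} - ?E" for x
  proof -
    have "x \<in> t ` ({0} \<times> {..<n - k} \<union> {1} \<times> {..<k})"
      using that bij_betw_imp_surj_on[OF bij] by blast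
    then obtain i j where ij: "x = t (i, j)" "i = 0 \<and> j < n - k \<or> i = 1 \<and> j < k" by auto
    moreover have "\<not> j < k"
      using that ij unfolding set_ends_tableau_pairs by auto
    ultimately show ?thesis by (intro exI[of _ j]) auto
  qed
  have col: "(\<forall>(i, j)\<in>young (two_row n k). \<exists>i'. (i', j) \<in> young (two_row n k) \<and> p (t (i, j)) = t (i', j))
      \<longleftrightarrow> (\<forall>j<k. p (t (0, j)) \<in> {t (0, j), t (1, j)} \<and> p (t (1, j)) \<in> {t (0, j), t (1, j)}) \<and>
          (\<forall>j. k \<le> j \<longrightarrow> j < n - k \<longrightarrow> p (t (0, j)) = t (0, j))" (is "?A \<longleftrightarrow> ?B") for p
  proof
    assume A: ?A
    have two: "p (t (i, j)) \<in> {t (0, j), t (1, j)}" if "(i, j) \<in> young (two_row n k)" for i j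
      using A that by (fastforce simp: young_two_row)
    have one: "p (t (0, j)) = t (0, j)" if "k \<le> j" "j < n - k" for j
    proof -
      have "(0, j) \<in> young (two_row n k)" using that by (simp add: young_two_row)
      then obtain i' where "(i', j) \<in> young (two_row n k)" "p (t (0, j)) = t (i', j)" using A by blast
      then show ?thesis using that by (auto simp: young_two_row)
    qed
    show ?B using two one k by (auto simp: young_two_row)
  next
    assume B: ?B
    show ?A
    proof (clarify)
      fix i j assume ij: "(i, j) \<in> young (two_row n k)"
      show "\<exists>i'. (i', j) \<in> young (two_row n k) \<and> p (t (i, j)) = t (i', j)"
      proof (cases "j < k")
        case True
        then have "p (t (i, j)) = t (0, j) \<or> p (t (i, j)) = t (1, j)"
          using B ij by (auto simp: young_two_row)
        moreover have "(0, j) \<in> young (two_row n k)" "(1, j) \<in> young (two_row n k)"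
          using True k by (auto simp: young_two_row)
        ultimately show ?thesis by blast
      next
        case False
        then show ?thesis using B ij by (auto simp: young_two_row)
      qed
    qed
  qed
  show ?thesis
  proof (rule subset_antisym; rule subsetI)
    fix p assume "p \<in> column_stabilizer n (two_row n k) t"
    then have p: "p permutes {1..n}"
      "\<forall>j<k. p (t (0, j)) \<in> {t (0, j), t (1, j)} \<and> p (t (1, j)) \<in> {t (0, j), t (1, j)}"
      "\<forall>j. k \<le> j \<longrightarrow> j < n - k \<longrightarrow> p (t (0, j)) = t (0, j)"
      unfolding column_stabilizer_def col by auto
    have "p permutes ?E"
      using outside p(3) by (intro permutes_superset[OF p(1)]) blast
    then show "p \<in> pair_stabilizer (tableau_pairs k t)"
      using p(2) by (auto simp: pair_stabilizer_def tableau_pairs_def)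
  next
    fix p assume p: "p \<in> pair_stabilizer (tableau_pairs k t)"
    then have perm: "p permutes ?E" by (simp add: pair_stabilizer_def)
    have "p permutes {1..n}" using permutes_subset[OF perm E] .
    moreover have "p (t (0, j)) \<in> {t (0, j), t (1, j)} \<and> p (t (1, j)) \<in> {t (0, j), t (1, j)}" if "j < k" for j
      using p that by (auto simp: pair_stabilizer_def tableau_pairs_def)
    moreover have "p (t (0, j)) = t (0, j)" if "k \<le> j" "j < n - k" for j
      using permutes_not_in[OF perm long[OF that]] .
    ultimately show "p \<in> column_stabilizer n (two_row n k) t"
      unfolding column_stabilizer_def col by blast
  qed
qed

lemma polytabloid_two_row:
  assumes k: "2 * k \<le> n" and t: "tableau n (two_row n k) t"
  shows "polytabloid n (two_row n k) t = alt (tableau_pairs k t) {} (tabloid_vec n)"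
proof -
  let ?ps = "tableau_pairs k t"
  have "tabloid (two_row n k) (p \<circ> t) = row_tabloid n (p ` fst ` set ?ps \<union> {})"
    if "p \<in> column_stabilizer n (two_row n k) t" for p
  proof -
    have "tableau n (two_row n k) (p \<circ> t)"
      using t that bij_betw_trans[of t _ "{1..n}" p "{1..n}"]
      unfolding tableau_def by (auto simp: column_stabilizer_def permutes_imp_bij)
    moreover have "(\<lambda>j. (p \<circ> t) (1, j)) ` {..<k} = p ` fst ` set ?ps \<union> {}"
      by (simp add: fst_tableau_pairs image_image)
    ultimately show ?thesis using tabloid_two_row by metis
  qed
  then have "polytabloid n (two_row n k) t = (\<Sum>p\<in>pair_stabilizer ?ps.
      pm_scale (of_int (sign p)) (tabloid_vec n (p ` fst ` set ?ps \<union> {})))"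
    unfolding polytabloid_def column_stabilizer_two_row[OF assms, symmetric]
    by (intro sum.cong) auto
  also have "\<dots> = alt ?ps {} (tabloid_vec n)"
    using tableau_pairs_mem[OF assms] by (intro sum_pair_stabilizer) (simp add: pair_lists_def)
  finally show ?thesis .
qed

text \<open>
  The points outside the pairs fill the rest of the first row in any order.
\<close>
lemma exists_tableau_with_pairs:
  assumes ps: "ps \<in> pair_lists n k"
  shows "\<exists>t. tableau n (two_row n k) t \<and> tableau_pairs k t = ps"
proof -
  have len: "length ps = k" and dist: "distinct (ends ps)" and sub: "set (ends ps) \<subseteq> {1..n}"
    using ps by (auto simp: pair_lists_def)
  define rest where "rest = sorted_list_of_set ({1..n} - set (ends ps))"
  define t :: "nat \<times> nat \<Rightarrow> nat" where
    "t = (\<lambda>(i, j). if i = 0 then (map snd ps @ rest) ! j else map fst ps ! j)"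
  have "length rest = n - 2 * k"
    using dist sub len by (simp add: rest_def card_Diff_subset distinct_card)
  moreover have "2 * k \<le> n"
    using card_mono[OF _ sub] distinct_card[OF dist] len by simp
  ultimately have len0: "length (map snd ps @ rest) = n - k" using len by simp
  have set0: "(\<lambda>j. t (0, j)) ` {..<n - k} = set (map snd ps @ rest)"
    using nth_image[of "n - k" "map snd ps @ rest"] len0
    by (simp add: t_def lessThan_atLeast0 cong del: image_cong_simp)
  have set1: "(\<lambda>j. t (1, j)) ` {..<k} = set (map fst ps)"
    using nth_image[of k "map fst ps"] len
    by (simp add: t_def lessThan_atLeast0 cong del: image_cong_simp)
  have im: "t ` young (two_row n k) = {1..n}"
  proof -
    have "t ` young (two_row n k) = (\<lambda>j. t (0, j)) ` {..<n - k} \<union> (\<lambda>j. t (1, j)) ` {..<k}"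
      unfolding young_two_row by (auto simp: image_iff)
    also have "\<dots> = set (ends ps) \<union> set rest" unfolding set0 set1 by (auto simp: ends_def)
    also have "\<dots> = {1..n}" using sub by (auto simp: rest_def)
    finally show ?thesis .
  qed
  have "card (young (two_row n k)) = n"
    unfolding young_two_row using \<open>2 * k \<le> n\<close>
    by (subst card_Un_disjoint) (auto simp: card_cartesian_product)
  then have "inj_on t (young (two_row n k))"
    using im by (intro eq_card_imp_inj_on) (auto simp: young_two_row)
  then have "tableau n (two_row n k) t" using im by (simp add: tableau_def bij_betw_def)
  moreover have "tableau_pairs k t = ps"
    using len by (intro nth_equalityI) (auto simp: tableau_pairs_def t_def nth_append)
  ultimately show ?thesis by blast
qed

lemma carrier_specht_two_row:
  assumes "2 * k \<le> n"
  shows "carrier (specht n (two_row n k)) =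
    pm.span ((\<lambda>ps. alt ps {} (tabloid_vec n)) ` pair_lists n k)"
proof -
  have "{polytabloid n (two_row n k) t | t. tableau n (two_row n k) t} =
      (\<lambda>ps. alt ps {} (tabloid_vec n)) ` pair_lists n k" (is "?A = ?B")
  proof
    show "?A \<subseteq> ?B"
      using polytabloid_two_row[OF assms] tableau_pairs_mem[OF assms] by auto
    show "?B \<subseteq> ?A"
      using polytabloid_two_row[OF assms] exists_tableau_with_pairs by (smt (verit) image_subsetI mem_Collect_eq)
  qed
  then show ?thesis by (simp add: specht_def)
qed

section \<open>Degree components\<close>

lemma exists_matching:
  assumes "T \<subseteq> {1..n}" "card T = 2 * d"
  shows "\<exists>P. matching n P \<and> \<Union>P = T \<and> card P = d"
  using assms
proof (induction d arbitrary: T)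
  case 0
  then have "T = {}" using finite_subset by fastforce
  then show ?case by (intro exI[of _ "{}"]) (simp add: matching_def)
next
  case (Suc d)
  have finT: "finite T" using Suc.prems finite_subset by blast
  obtain a where a: "a \<in> T" using Suc.prems by fastforce
  have "card (T - {a}) = Suc (2 * d)" using a Suc.prems finT by simp
  then have "T - {a} \<noteq> {}" by (metis card.empty nat.distinct(1))
  then obtain b where b: "b \<in> T - {a}" by blast
  have "card (T - {a} - {b}) = 2 * d" using b \<open>card (T - {a}) = Suc (2 * d)\<close> finT by simp
  then obtain P where P: "matching n P" "\<Union>P = T - {a} - {b}" "card P = d"
    using Suc.IH[of "T - {a} - {b}"] Suc.prems(1) by blast
  have "disjnt {a, b} S" if "S \<in> P" for S using P(2) that by (auto simp: disjnt_def)
  moreover have "{a, b} \<in> edges n" using a b Suc.prems by (auto simp: edges_doubleton_iff)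
  moreover have "{a, b} \<notin> P" using P(2) by auto
  ultimately show ?case using P a b matching_finite[OF P(1)]
    by (intro exI[of _ "insert {a, b} P"]) (auto simp: matching_insert)
qed

text \<open>
  By \<open>matching_poly_cong\<close>, the choice of the matching does not matter modulo the ideal.
\<close>
definition set_poly :: "nat \<Rightarrow> nat set \<Rightarrow> mpoly" where
  "set_poly n T = matching_poly (SOME P. matching n P \<and> \<Union>P = T)"

lemma set_poly_eq_matching_poly:
  assumes "T \<subseteq> {1..n}" "card T = 2 * d"
  obtains P where "matching n P" "\<Union>P = T" "card P = d" "set_poly n T = matching_poly P"
proof -
  define P where "P = (SOME P. matching n P \<and> \<Union>P = T)"
  have "\<exists>P. matching n P \<and> \<Union>P = T" using exists_matching[OF assms] by blast
  from someI_ex[OF this] have P: "matching n P" "\<Union>P = T" unfolding P_def by auto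
  moreover have "card P = d" using card_matching_Union[OF P(1)] P(2) assms by simp
  moreover have "set_poly n T = matching_poly P" by (simp add: set_poly_def P_def)
  ultimately show ?thesis using that by blast
qed

lemma matching_poly_cong_set_poly:
  assumes "matching n P"
  shows "matching_poly P - set_poly n (\<Union>P) \<in> J_ideal n"
proof -
  obtain Q where "matching n Q" "\<Union>Q = \<Union>P" "card Q = card P"
    "set_poly n (\<Union>P) = matching_poly Q"
    by (rule set_poly_eq_matching_poly[OF matching_Union[OF assms] card_matching_Union[OF assms]])
  then show ?thesis using matching_poly_cong[OF assms, of Q] by simp
qed

text \<open>
  Since \<open>W\<close> has an odd number of elements, it can be covered by a point \<open>i\<close> and a matching of
  \<open>W - {i}\<close>.  The relation is the linear generator at \<open>i\<close> times this matching: the terms with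
  \<open>j \<in> W\<close> contain a product of intersecting variables, and the other ones are matchings of
  \<open>insert j W\<close>.
\<close>
lemma sum_set_poly_mem:
  assumes W: "W \<subseteq> {1..n}" "Suc (card W) = 2 * d"
  shows "(\<Sum>c\<in>{1..n} - W. set_poly n (insert c W)) \<in> J_ideal n"
proof -
  have finW: "finite W" using W finite_subset by blast
  obtain e where d: "d = Suc e" using W by (cases d) auto
  then obtain i where i: "i \<in> W" using W by fastforce
  then have card: "card (W - {i}) = 2 * e" using W d finW by simp
  have "W - {i} \<subseteq> {1..n}" using W(1) by blast
  from exists_matching[OF this card] obtain P where P: "matching n P" "\<Union>P = W - {i}" by blast
  have star: "matching_poly P * (\<Sum>j\<in>{1..n} - {i}. xvar {i, j}) \<in> J_ideal n"
    using i W by (intro J_mult J_star edge_polys_matching_poly P) auto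
  have split: "matching_poly P * (\<Sum>j\<in>{1..n} - {i}. xvar {i, j}) =
      (\<Sum>j\<in>W - {i}. matching_poly P * xvar {i, j}) + (\<Sum>j\<in>{1..n} - W. matching_poly P * xvar {i, j})"
  proof -
    have "{1..n} - {i} = (W - {i}) \<union> ({1..n} - W)" using W i by blast
    then show ?thesis using finW
      by (simp only: sum_distrib_left) (subst sum.union_disjoint, auto)
  qed
  have "(\<Sum>j\<in>W - {i}. matching_poly P * xvar {i, j}) \<in> J_ideal n"
  proof (intro pm.subspace_sum[OF J_subspace])
    fix j assume j: "j \<in> W - {i}"
    then obtain S where S: "S \<in> P" "j \<in> S" using P by blast
    then have "matching_poly P * xvar {i, j} = matching_poly (P - {S}) * (xvar S * xvar {i, j})"
      using matching_poly_remove[of P S] matching_finite[OF P(1)] by (simp add: algebra_simps)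
    moreover have "xvar S * xvar {i, j} \<in> J_ideal n"
      using S P(1) i j W by (intro J_prod_intersecting) (auto simp: matching_def edges_doubleton_iff)
    moreover have "matching_poly (P - {S}) \<in> edge_polys n"
      using P(1) by (intro edge_polys_matching_poly) (auto intro: matching_subset)
    ultimately show "matching_poly P * xvar {i, j} \<in> J_ideal n" by auto
  qed
  from J_diff[OF star this]
  have *: "(\<Sum>j\<in>{1..n} - W. matching_poly P * xvar {i, j}) \<in> J_ideal n"
    unfolding split by simp
  have "(\<Sum>j\<in>{1..n} - W. matching_poly P * xvar {i, j} - set_poly n (insert j W)) \<in> J_ideal n"
  proof (intro pm.subspace_sum[OF J_subspace])
    fix j assume j: "j \<in> {1..n} - W"
    have new: "{i, j} \<notin> P" using P(2) by blast
    have "disjnt {i, j} S" if "S \<in> P" for S using P(2) that j by (auto simp: disjnt_def)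
    then have "matching n (insert {i, j} P)"
      using j i W P by (auto simp: matching_insert edges_doubleton_iff)
    moreover have "\<Union>(insert {i, j} P) = insert j W" using P(2) i by auto
    moreover have "matching_poly (insert {i, j} P) = matching_poly P * xvar {i, j}"
      using new matching_finite[OF P(1)] by (simp add: matching_poly_def mult.commute)
    ultimately show "matching_poly P * xvar {i, j} - set_poly n (insert j W) \<in> J_ideal n"
      using matching_poly_cong_set_poly by metis
  qed
  from J_diff[OF * this] show ?thesis by (simp add: sum_subtractf)
qed

text \<open>
  The carrier of the Specht module of shape \<open>(n - k, k)\<close>, described without tableaux.  This form
  also makes sense for \<open>n < 2 * k\<close>, where it is the zero space.
\<close>
definition specht_space :: "nat \<Rightarrow> nat \<Rightarrow> (nat set list \<Rightarrow>\<^sub>0 complex) set" where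
  "specht_space n k = pm.span ((\<lambda>ps. alt ps {} (tabloid_vec n)) ` pair_lists n k)"

lemma subspace_specht_space: "pm.subspace (specht_space n k)"
  by (simp add: specht_space_def)

lemma specht_space_trivial: "n < 2 * k \<Longrightarrow> specht_space n k = {0}"
proof -
  assume *: "n < 2 * k"
  have "2 * k \<le> n" if "ps \<in> pair_lists n k" for ps
    using that card_mono[of "{1..n}" "set (ends ps)"] distinct_card[of "ends ps"]
    by (auto simp: pair_lists_def)
  then have "pair_lists n k = {}" using * by fastforce
  then show ?thesis by (simp add: specht_space_def)
qed

lemma alt_mem:
  assumes N: "pm.subspace N" and ps: "ps \<in> pair_lists n k"
    and "\<And>T. T \<subseteq> {1..n} \<Longrightarrow> card T = k \<Longrightarrow> \<phi> T \<in> N"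
  shows "alt ps {} \<phi> \<in> N"
proof -
  define \<psi> where "\<psi> T = (if T \<subseteq> {1..n} \<and> card T = k then \<phi> T else 0)" for T
  have "\<psi> T \<in> N" for T using assms(3) pm.subspace_0[OF N] by (simp add: \<psi>_def)
  then have "alt qs F \<psi> \<in> N" for qs F
    by (induction qs F \<psi> rule: alt.induct) (auto intro: pm.subspace_diff[OF N])
  moreover have "alt ps {} \<phi> = alt ps {} \<psi>"
    using ps by (intro alt_cong) (auto simp: \<psi>_def pair_lists_def)
  ultimately show ?thesis by simp
qed

lemma specht_space_induct [consumes 1]:
  assumes "v \<in> specht_space n k" "pm.subspace N"
    and "\<And>ps. ps \<in> pair_lists n k \<Longrightarrow> alt ps {} (tabloid_vec n) \<in> N"
  shows "v \<in> N"
proof -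
  have "specht_space n k \<subseteq> N"
    unfolding specht_space_def using assms(2,3) by (intro pm.span_minimal) auto
  then show ?thesis using assms(1) by (rule subsetD)
qed

lemma subspace_supported: "pm.subspace {v. Poly_Mapping.keys v \<subseteq> A}"
proof (rule pm.subspaceI)
  fix u v :: "'a \<Rightarrow>\<^sub>0 complex"
  assume "u \<in> {v. Poly_Mapping.keys v \<subseteq> A}" "v \<in> {v. Poly_Mapping.keys v \<subseteq> A}"
  then show "u + v \<in> {v. Poly_Mapping.keys v \<subseteq> A}" using Poly_Mapping.keys_add[of u v] by blast
next
  fix c and v :: "'a \<Rightarrow>\<^sub>0 complex"
  assume "v \<in> {v. Poly_Mapping.keys v \<subseteq> A}"
  then show "pm_scale c v \<in> {v. Poly_Mapping.keys v \<subseteq> A}" using keys_pm_scale[of c v] by blast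
qed simp

lemma keys_specht_space:
  assumes "v \<in> specht_space n k"
  shows "Poly_Mapping.keys v \<subseteq> row_tabloid n ` {T. T \<subseteq> {1..n} \<and> card T = k}"
proof -
  have "v \<in> {v. Poly_Mapping.keys v \<subseteq> row_tabloid n ` {T. T \<subseteq> {1..n} \<and> card T = k}}"
    using assms subspace_supported
  proof (rule specht_space_induct)
    fix ps assume "ps \<in> pair_lists n k"
    then show "alt ps {} (tabloid_vec n) \<in>
        {v. Poly_Mapping.keys v \<subseteq> row_tabloid n ` {T. T \<subseteq> {1..n} \<and> card T = k}}"
      by (rule alt_mem[OF subspace_supported]) simp
  qed
  then show ?thesis by simp
qed

lemma row_tabloid_eq_iff [simp]: "row_tabloid n T = row_tabloid n U \<longleftrightarrow> T = U"
  by (metis second_row_tabloid)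

lemma sum_lookup_specht_space:
  assumes "v \<in> specht_space n k" and W: "W \<subseteq> {1..n}" "Suc (card W) = k"
  shows "(\<Sum>c\<in>{1..n} - W. Poly_Mapping.lookup v (row_tabloid n (insert c W))) = 0"
proof -
  let ?N = "{v :: nat set list \<Rightarrow>\<^sub>0 complex.
    (\<Sum>c\<in>{1..n} - W. Poly_Mapping.lookup v (row_tabloid n (insert c W))) = 0}"
  have "pm.subspace ?N"
  proof (rule pm.subspaceI)
    fix c v assume "v \<in> ?N"
    moreover have "(\<Sum>e\<in>{1..n} - W. Poly_Mapping.lookup (pm_scale c v) (row_tabloid n (insert e W))) =
        c * (\<Sum>e\<in>{1..n} - W. Poly_Mapping.lookup v (row_tabloid n (insert e W)))"
      unfolding lookup_pm_scale by (rule sum_distrib_left[symmetric])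
    ultimately show "pm_scale c v \<in> ?N" by simp
  qed (simp_all add: lookup_add sum.distrib)
  with assms(1) have "v \<in> ?N"
  proof (rule specht_space_induct)
    fix ps assume ps: "ps \<in> pair_lists n k"
    have "Poly_Mapping.lookup (alt ps {} (tabloid_vec n)) (row_tabloid n U) =
        alt ps {} (\<lambda>T. if T = U then 1 else 0)" for U
      by (subst alt_additive[where h = "\<lambda>v. Poly_Mapping.lookup v (row_tabloid n U)"])
        (simp_all add: lookup_minus lookup_single when_def)
    then show "alt ps {} (tabloid_vec n) \<in> ?N"
      using sum_alt_indicator[of "{1..n}" W ps] ps W by (simp add: pair_lists_def)
  qed
  then show ?thesis by simp
qed

text \<open>
  A representative, modulo the ideal, of the image of a combination of tabloids in the quotient.
\<close>
definition to_poly :: "nat \<Rightarrow> (nat set list \<Rightarrow>\<^sub>0 complex) \<Rightarrow> mpoly" where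
  "to_poly n = lin_ext pm_scale (\<lambda>\<tau>. set_poly n (second_row \<tau>))"

lemma to_poly_simps:
  "to_poly n 0 = 0" "to_poly n (u + v) = to_poly n u + to_poly n v"
  "to_poly n (u - v) = to_poly n u - to_poly n v"
  "to_poly n (pm_scale c v) = pm_scale c (to_poly n v)"
  by (simp_all add: to_poly_def pm_ext_simps)

lemma to_poly_alt: "to_poly n (alt ps F (tabloid_vec n)) = alt ps F (set_poly n)"
  by (subst alt_additive[where h = "to_poly n"]) (simp_all add: to_poly_simps, simp add: to_poly_def pm_ext_simps)

text \<open>
  Pair \<open>v\<close> with itself: the functional built from the conjugate coefficients of \<open>v\<close> vanishes on the
  ideal, and at \<open>to_poly n v\<close> it is a sum of squared absolute values.
\<close>
lemma to_poly_mem_J_imp_0: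
  assumes v: "v \<in> specht_space n (2 * d)" and J: "to_poly n v \<in> J_ideal n"
  shows "v = 0"
proof -
  define w where "w T = cnj (Poly_Mapping.lookup v (row_tabloid n T))" for T
  have "matching_functional d w (to_poly n v) = 0"
  proof (rule matching_functional_vanishes[OF _ J])
    fix W assume "W \<subseteq> {1..n}" "Suc (card W) = 2 * d"
    from arg_cong[OF sum_lookup_specht_space[OF v this], of cnj]
    show "(\<Sum>c\<in>{1..n} - W. w (insert c W)) = 0"
      unfolding w_def by simp
  qed
  moreover have "matching_functional d w (to_poly n v) =
      (\<Sum>\<tau>\<in>Poly_Mapping.keys v. Poly_Mapping.lookup v \<tau> *
        matching_functional d w (set_poly n (second_row \<tau>)))"
    by (simp add: to_poly_def lin_ext_def[of pm_scale] fun_ext_simps)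
  moreover have "\<dots> = (\<Sum>\<tau>\<in>Poly_Mapping.keys v. of_real ((cmod (Poly_Mapping.lookup v \<tau>))\<^sup>2))"
  proof (intro sum.cong refl)
    fix \<tau> assume "\<tau> \<in> Poly_Mapping.keys v"
    then obtain T where T: "\<tau> = row_tabloid n T" "T \<subseteq> {1..n}" "card T = 2 * d"
      using keys_specht_space[OF v] by auto
    obtain P where "matching n P" "\<Union>P = T" "card P = d" "set_poly n T = matching_poly P"
      using set_poly_eq_matching_poly[OF T(2,3)] by blast
    then have "matching_functional d w (set_poly n T) = w T"
      using matching_functional_matching_poly[of n P w] by simp
    then show "Poly_Mapping.lookup v \<tau> * matching_functional d w (set_poly n (second_row \<tau>)) =
        of_real ((cmod (Poly_Mapping.lookup v \<tau>))\<^sup>2)"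
      using T by (simp only: second_row_tabloid w_def complex_norm_square)
  qed
  ultimately have "(\<Sum>\<tau>\<in>Poly_Mapping.keys v.
      complex_of_real ((cmod (Poly_Mapping.lookup v \<tau>))\<^sup>2)) = 0"
    by simp
  then have "(\<Sum>\<tau>\<in>Poly_Mapping.keys v. (cmod (Poly_Mapping.lookup v \<tau>))\<^sup>2) = 0"
    unfolding of_real_sum[symmetric] by (simp only: of_real_eq_0_iff)
  then have "Poly_Mapping.lookup v \<tau> = 0" if "\<tau> \<in> Poly_Mapping.keys v" for \<tau>
    using that by (subst (asm) sum_nonneg_eq_0_iff) auto
  then have "Poly_Mapping.lookup v \<tau> = 0" for \<tau>
    by (cases "\<tau> \<in> Poly_Mapping.keys v") (simp_all add: in_keys_iff)
  then show ?thesis by (intro poly_mapping_eqI) simp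
qed

definition homog_space :: "nat \<Rightarrow> nat \<Rightarrow> mpoly set" where
  "homog_space n d = {p \<in> edge_polys n. homogeneous d p}"

lemma subspace_homog_space: "pm.subspace (homog_space n d)"
proof (rule pm.subspaceI)
  fix p q assume "p \<in> homog_space n d" "q \<in> homog_space n d"
  then show "p + q \<in> homog_space n d"
    using Poly_Mapping.keys_add[of p q] by (auto simp: homog_space_def homogeneous_def)
next
  fix c p assume "p \<in> homog_space n d"
  then show "pm_scale c p \<in> homog_space n d"
    using keys_pm_scale[of c p] by (auto simp: homog_space_def homogeneous_def)
qed (simp add: homog_space_def homogeneous_def)

lemma matching_poly_homog: "matching n P \<Longrightarrow> matching_poly P \<in> homog_space n (card P)"
  using edge_polys_matching_poly[of n P] matching_finite[of n P]
  by (simp add: homog_space_def homogeneous_def matching_poly_eq keys_matching_mono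
      lookup_matching_mono)

lemma set_poly_homog:
  assumes "T \<subseteq> {1..n}" "card T = 2 * d"
  shows "set_poly n T \<in> homog_space n d"
proof -
  obtain P where "matching n P" "card P = d" "set_poly n T = matching_poly P"
    using set_poly_eq_matching_poly[OF assms] by blast
  then show ?thesis using matching_poly_homog[of n P] by simp
qed

lemma to_poly_homog: "v \<in> specht_space n (2 * d) \<Longrightarrow> to_poly n v \<in> homog_space n d"
proof -
  assume v: "v \<in> specht_space n (2 * d)"
  have "pm.subspace {v. to_poly n v \<in> homog_space n d}"
    using subspace_homog_space[of n d] by (auto simp: pm.subspace_def to_poly_simps)
  with v have "v \<in> {v. to_poly n v \<in> homog_space n d}"
  proof (rule specht_space_induct)
    show "alt ps {} (tabloid_vec n) \<in> {v. to_poly n v \<in> homog_space n d}"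
      if "ps \<in> pair_lists n (2 * d)" for ps
      using alt_mem[OF subspace_homog_space that set_poly_homog] by (simp add: to_poly_alt)
  qed
  then show ?thesis by simp
qed

text \<open>
  The polynomials that are congruent to the image of an element of the Specht module form a
  subspace \<open>N\<close>.  It contains the relations \<open>sum_set_poly_mem\<close> and the images of the polytabloids,
  so \<open>mem_if_alt_mem\<close> applies.
\<close>
lemma set_poly_reduces:
  assumes T: "T \<subseteq> {1..n}" "card T = 2 * d"
  shows "\<exists>v\<in>specht_space n (2 * d). set_poly n T - to_poly n v \<in> J_ideal n"
proof -
  define N where "N = {p. \<exists>v\<in>specht_space n (2 * d). p - to_poly n v \<in> J_ideal n}"
  have N: "pm.subspace N"
  proof (rule pm.subspaceI)
    show "0 \<in> N"
      unfolding N_def using pm.subspace_0[OF subspace_specht_space, of n "2 * d"]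
      by (auto simp: to_poly_simps intro!: bexI[of _ 0])
  next
    fix p q assume "p \<in> N" "q \<in> N"
    then obtain u v where uv: "u \<in> specht_space n (2 * d)" "v \<in> specht_space n (2 * d)"
      and J: "p - to_poly n u \<in> J_ideal n" "q - to_poly n v \<in> J_ideal n"
      by (auto simp: N_def)
    have "p + q - to_poly n (u + v) \<in> J_ideal n"
      using J_add[OF J] by (simp add: to_poly_simps algebra_simps)
    then show "p + q \<in> N"
      unfolding N_def using pm.subspace_add[OF subspace_specht_space uv] by blast
  next
    fix c p assume "p \<in> N"
    then obtain v where v: "v \<in> specht_space n (2 * d)" and J: "p - to_poly n v \<in> J_ideal n"
      by (auto simp: N_def)
    have "pm_scale c p - to_poly n (pm_scale c v) \<in> J_ideal n"
      using J_pm_scale[OF J, of c] by (simp add: to_poly_simps pm.scale_right_diff_distrib)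
    then show "pm_scale c p \<in> N"
      unfolding N_def using pm.subspace_scale[OF subspace_specht_space v] by blast
  qed
  have J_sub: "J_ideal n \<subseteq> N"
  proof
    fix p assume "p \<in> J_ideal n"
    then have "p - to_poly n 0 \<in> J_ideal n" by (simp add: to_poly_simps)
    then show "p \<in> N"
      unfolding N_def using pm.subspace_0[OF subspace_specht_space, of n "2 * d"] by blast
  qed
  have "set_poly n T \<in> N"
  proof (rule mem_if_alt_mem[OF pm.vector_space_axioms N, of "{1..n}" "2 * d"])
    fix W assume "W \<subseteq> {1..n}" "Suc (card W) = 2 * d"
    then show "(\<Sum>c\<in>{1..n} - W. set_poly n (insert c W)) \<in> N"
      using sum_set_poly_mem J_sub by blast
  next
    fix ps :: "(nat \<times> nat) list"
    assume "length ps = 2 * d" "distinct (ends ps)" "set (ends ps) \<subseteq> {1..n}"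
    then have "alt ps {} (tabloid_vec n) \<in> specht_space n (2 * d)"
      unfolding specht_space_def by (intro pm.span_base imageI) (simp add: pair_lists_def)
    moreover have "alt ps {} (set_poly n) - to_poly n (alt ps {} (tabloid_vec n)) \<in> J_ideal n"
      by (simp add: to_poly_alt)
    ultimately show "alt ps {} (set_poly n) \<in> N" unfolding N_def by blast
  qed (use T in auto)
  then show ?thesis by (simp add: N_def)
qed

text \<open>
  A monomial outside the ideal is squarefree with pairwise disjoint variables, so it is a matching and
  congruent to a polynomial \<open>set_poly n T\<close>.
\<close>
lemma homog_space_reduces:
  assumes p: "p \<in> homog_space n d"
  shows "\<exists>v\<in>specht_space n (2 * d). p - to_poly n v \<in> J_ideal n"
proof -
  have mono: "\<exists>v\<in>specht_space n (2 * d). Poly_Mapping.single m c - to_poly n v \<in> J_ideal n"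
    if m: "m \<in> Poly_Mapping.keys p" for m c
  proof -
    have sub: "Poly_Mapping.keys m \<subseteq> edges n"
      and deg: "(\<Sum>S\<in>Poly_Mapping.keys m. Poly_Mapping.lookup m S) = d"
      using p m by (auto simp: homog_space_def mem_edge_polys homogeneous_def)
    show ?thesis
    proof (cases "Poly_Mapping.single m c \<in> J_ideal n")
      case True
      then show ?thesis
        using pm.subspace_0[OF subspace_specht_space, of n "2 * d"]
        by (intro bexI[of _ 0]) (simp_all add: to_poly_simps)
    next
      case False
      \<comment> \<open>A monomial divisible by two intersecting variables lies in the ideal.\<close>
      have no_meet: "S \<inter> T = {}"
        if "S \<in> edges n" "T \<in> edges n" "m = Poly_Mapping.single S 1 + (Poly_Mapping.single T 1 + r)"
          "Poly_Mapping.keys r \<subseteq> edges n" for S T r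
      proof (rule ccontr)
        assume "S \<inter> T \<noteq> {}"
        then have "Poly_Mapping.single r c * (xvar S * xvar T) \<in> J_ideal n"
          using that by (intro J_mult J_prod_intersecting edge_polys_single)
        moreover have "Poly_Mapping.single r c * (xvar S * xvar T) = Poly_Mapping.single m c"
          unfolding that(3) xvar_def mult_single by (simp add: add.commute add.left_commute)
        ultimately show False using False by simp
      qed
      have split_off_variable: "\<exists>r :: mono. m' = Poly_Mapping.single S 1 + r \<and> Poly_Mapping.keys r \<subseteq> Poly_Mapping.keys m'
          \<and> (\<forall>T. Poly_Mapping.lookup r T = Poly_Mapping.lookup m' T - (if T = S then 1 else 0))"
        if "S \<in> Poly_Mapping.keys m'" for S m'
        using that
        by (intro exI[of _ "m' - Poly_Mapping.single S 1"])
          (auto simp: lookup_minus lookup_single lookup_add in_keys_iff when_def intro!: poly_mapping_eqI)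
      have one: "Poly_Mapping.lookup m S \<le> 1" for S
      proof (rule ccontr)
        assume *: "\<not> Poly_Mapping.lookup m S \<le> 1"
        then have S: "S \<in> Poly_Mapping.keys m" by (auto simp: in_keys_iff)
        obtain r where r: "m = Poly_Mapping.single S 1 + r" "Poly_Mapping.keys r \<subseteq> Poly_Mapping.keys m"
          "\<forall>T. Poly_Mapping.lookup r T = Poly_Mapping.lookup m T - (if T = S then 1 else 0)"
          using split_off_variable[OF S] by blast
        have "S \<in> Poly_Mapping.keys r" using * r(3) by (auto simp: in_keys_iff)
        then obtain r' where r': "r = Poly_Mapping.single S 1 + r'" "Poly_Mapping.keys r' \<subseteq> Poly_Mapping.keys r"
          using split_off_variable by blast
        have "S \<inter> S = {}" using no_meet[of S S r'] r r' S sub by blast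
        moreover have "S \<noteq> {}" using S sub by (auto simp: edges_def)
        ultimately show False by simp
      qed
      have disj: "disjnt S T" if ST: "S \<in> Poly_Mapping.keys m" "T \<in> Poly_Mapping.keys m" "S \<noteq> T" for S T
      proof -
        obtain r where r: "m = Poly_Mapping.single S 1 + r" "Poly_Mapping.keys r \<subseteq> Poly_Mapping.keys m"
          "\<forall>T. Poly_Mapping.lookup r T = Poly_Mapping.lookup m T - (if T = S then 1 else 0)"
          using split_off_variable[OF ST(1)] by blast
        have "T \<in> Poly_Mapping.keys r" using ST r(3) by (auto simp: in_keys_iff)
        then obtain r' where r': "r = Poly_Mapping.single T 1 + r'" "Poly_Mapping.keys r' \<subseteq> Poly_Mapping.keys r"
          using split_off_variable by blast
        have "S \<inter> T = {}" using no_meet[of S T r'] r r' ST sub by blast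
        then show ?thesis by (simp add: disjnt_def)
      qed
      define P where "P = Poly_Mapping.keys m"
      have P: "matching n P" using sub disj by (auto simp: P_def matching_def pairwise_def)
      have lookup_one: "Poly_Mapping.lookup m S = 1" if "S \<in> P" for S
        using that one[of S] by (auto simp: P_def in_keys_iff le_Suc_eq)
      have "m = matching_mono P"
        using lookup_one by (intro poly_mapping_eqI) (auto simp: lookup_matching_mono P_def in_keys_iff)
      then have m_eq: "Poly_Mapping.single m c = pm_scale c (matching_poly P)"
        using matching_finite[OF P] by (simp add: matching_poly_eq)
      have "card P = d" using deg lookup_one by (simp add: P_def[symmetric])
      then have "\<Union>P \<subseteq> {1..n}" "card (\<Union>P) = 2 * d"
        using matching_Union[OF P] card_matching_Union[OF P] by auto
      from set_poly_reduces[OF this] obtain v where v: "v \<in> specht_space n (2 * d)"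
        and J: "set_poly n (\<Union>P) - to_poly n v \<in> J_ideal n" by blast
      have "matching_poly P - to_poly n v \<in> J_ideal n"
        using J_add[OF matching_poly_cong_set_poly[OF P] J] by simp
      from J_pm_scale[OF this, of c]
      have "Poly_Mapping.single m c - to_poly n (pm_scale c v) \<in> J_ideal n"
        by (simp add: m_eq to_poly_simps pm.scale_right_diff_distrib)
      then show ?thesis using pm.subspace_scale[OF subspace_specht_space v] by blast
    qed
  qed
  define V where "V m = (SOME v. v \<in> specht_space n (2 * d) \<and>
    Poly_Mapping.single m (Poly_Mapping.lookup p m) - to_poly n v \<in> J_ideal n)" for m
  have V: "V m \<in> specht_space n (2 * d) \<and>
    Poly_Mapping.single m (Poly_Mapping.lookup p m) - to_poly n (V m) \<in> J_ideal n"
    if "m \<in> Poly_Mapping.keys p" for m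
    unfolding V_def by (rule someI_ex) (use mono[OF that, of "Poly_Mapping.lookup p m"] in blast)
  have "(\<Sum>m\<in>Poly_Mapping.keys p. Poly_Mapping.single m (Poly_Mapping.lookup p m) - to_poly n (V m)) \<in> J_ideal n"
    using V by (intro pm.subspace_sum[OF J_subspace]) blast
  then have "p - to_poly n (\<Sum>m\<in>Poly_Mapping.keys p. V m) \<in> J_ideal n"
    by (simp add: sum_subtractf sum_singles to_poly_def pm_ext_simps)
  moreover have "(\<Sum>m\<in>Poly_Mapping.keys p. V m) \<in> specht_space n (2 * d)"
    using V by (intro pm.subspace_sum[OF subspace_specht_space]) blast
  ultimately show ?thesis by blast
qed

section \<open>The action of the symmetric group\<close>

lemma keys_pushforward: "Poly_Mapping.keys (pushforward f p) \<subseteq> f ` Poly_Mapping.keys p"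
  unfolding pushforward_def using Poly_Mapping.keys_sum
  by (rule subset_trans) (auto split: if_splits)

lemma pushforward_pm_scale: "pushforward f (pm_scale c p) = pm_scale c (pushforward f p)"
  by (induction p rule: pm_induct) (simp_all add: pushforward_add pm.scale_right_distrib)

lemma pushforward_diff: "pushforward f (p - q) = pushforward f p - pushforward f (q :: 'a \<Rightarrow>\<^sub>0 'c::ab_group_add)"
  using pushforward_add[of f "p - q" q] by simp

lemma pushforward_comp: "pushforward (f \<circ> g) p = pushforward f (pushforward g p)"
  by (induction p rule: pm_induct) (simp_all add: pushforward_add)

lemma pushforward_id: "pushforward id p = p"
  by (induction p rule: pm_induct) (simp_all add: pushforward_add)

lemma perm_mono_comp: "perm_mono (w \<circ> w') = perm_mono w \<circ> perm_mono w'"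
proof -
  have *: "(`) (w \<circ> w') = (`) w \<circ> (`) w'" by (auto simp: fun_eq_iff)
  show ?thesis
    unfolding perm_mono_def by (intro ext) (simp only: * pushforward_comp comp_apply)
qed

lemma perm_poly_comp: "perm_poly (w \<circ> w') p = perm_poly w (perm_poly w' p)"
  by (simp add: perm_poly_def perm_mono_comp pushforward_comp)

lemma perm_poly_id [simp]: "perm_poly id p = p"
proof -
  have "perm_mono id = id" by (simp add: perm_mono_def fun_eq_iff pushforward_id image_id[THEN fun_cong] flip: id_def)
  then show ?thesis by (simp add: perm_poly_def pushforward_id)
qed

lemma perm_poly_linear:
  "perm_poly w 0 = 0" "perm_poly w (p - q) = perm_poly w p - perm_poly w q"
  "perm_poly w (pm_scale c p) = pm_scale c (perm_poly w p)"
  by (simp_all add: perm_poly_def pushforward_diff pushforward_pm_scale)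

lemma perm_poly_sum: "perm_poly w (\<Sum>i\<in>A. f i) = (\<Sum>i\<in>A. perm_poly w (f i))"
  by (induction A rule: infinite_finite_induct) (simp_all add: perm_poly_linear perm_poly_add)

lemma perm_poly_prod: "perm_poly w (\<Prod>i\<in>A. f i) = (\<Prod>i\<in>A. perm_poly w (f i))"
proof -
  have "perm_poly w 1 = 1" using perm_poly_const[of w 1] by simp
  then show ?thesis
    by (induction A rule: infinite_finite_induct) (simp_all add: perm_poly_mult)
qed

lemma edges_image: "w permutes {1..n} \<Longrightarrow> S \<in> edges n \<Longrightarrow> w ` S \<in> edges n"
  unfolding edges_def using permutes_image[of w "{1..n}"]
  by (auto simp: card_image permutes_inj_on)

lemma perm_mono_keys: "Poly_Mapping.keys (perm_mono w m) \<subseteq> (`) w ` Poly_Mapping.keys m"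
  unfolding perm_mono_def by (rule keys_pushforward)

lemma perm_poly_edge_polys: "w permutes {1..n} \<Longrightarrow> p \<in> edge_polys n \<Longrightarrow> perm_poly w p \<in> edge_polys n"
proof -
  assume w: "w permutes {1..n}" and p: "p \<in> edge_polys n"
  have "Poly_Mapping.keys (perm_mono w m) \<subseteq> edges n" if "m \<in> Poly_Mapping.keys p" for m
    using perm_mono_keys[of w m] edges_image[OF w] p that by (auto simp: mem_edge_polys)
  then have "\<forall>m\<in>perm_mono w ` Poly_Mapping.keys p. Poly_Mapping.keys m \<subseteq> edges n" by blast
  then show ?thesis
    using keys_pushforward[of "perm_mono w" p] unfolding mem_edge_polys perm_poly_def by blast
qed

definition mono_degree :: "mono \<Rightarrow> nat" where
  "mono_degree m = (\<Sum>S\<in>Poly_Mapping.keys m. Poly_Mapping.lookup m S)"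

lemma mono_degree_superset:
  "finite A \<Longrightarrow> Poly_Mapping.keys m \<subseteq> A \<Longrightarrow> mono_degree m = (\<Sum>S\<in>A. Poly_Mapping.lookup m S)"
  unfolding mono_degree_def by (intro sum.mono_neutral_left) (auto simp: in_keys_iff)

lemma mono_degree_add: "mono_degree (a + b) = mono_degree a + mono_degree b"
  using Poly_Mapping.keys_add[of a b]
  by (simp add: mono_degree_superset[of "Poly_Mapping.keys a \<union> Poly_Mapping.keys b"]
      lookup_add sum.distrib)

lemma mono_degree_perm_mono: "mono_degree (perm_mono w m) = mono_degree m"
proof (induction m rule: pm_induct)
  case zero
  show ?case by (simp add: perm_mono_def)
next
  case (add_single m S e)
  have "mono_degree (Poly_Mapping.single T e) = e" for T
    by (subst mono_degree_superset[of "{T}"]) auto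
  with add_single show ?case
    by (simp add: perm_mono_def pushforward_add mono_degree_add)
qed

lemma perm_poly_homog:
  assumes "w permutes {1..n}" "p \<in> homog_space n d"
  shows "perm_poly w p \<in> homog_space n d"
proof -
  have "homogeneous d p" "p \<in> edge_polys n" using assms by (auto simp: homog_space_def)
  then have "homogeneous d (perm_poly w p)"
    using keys_pushforward[of "perm_mono w" p]
    by (auto simp: homogeneous_def perm_poly_def mono_degree_def[symmetric] mono_degree_perm_mono)
  then show ?thesis using perm_poly_edge_polys assms \<open>p \<in> edge_polys n\<close> by (simp add: homog_space_def)
qed

lemma perm_poly_J:
  assumes w: "w permutes {1..n}" and p: "p \<in> J_ideal n"
  shows "perm_poly w p \<in> J_ideal n"
  using p
proof (induction p rule: J_induct)
  case (gen g)
  have inj: "inj w" using permutes_inj[OF w] .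
  have in_n: "w i \<in> {1..n} \<longleftrightarrow> i \<in> {1..n}" for i using permutes_in_image[OF w] .
  from gen consider
    (star) i where "i \<in> {1..n}" "g = (\<Sum>j\<in>{1..n} - {i}. xvar {i, j})"
    | (meet) S T where "S \<in> edges n" "T \<in> edges n" "S \<inter> T \<noteq> {}" "g = xvar S * xvar T"
    | (swap) i j k l where "{i, j, k, l} \<subseteq> {1..n}" "distinct [i, j, k, l]"
        "g = xvar {i, j} * xvar {k, l} - xvar {i, k} * xvar {j, l}"
    unfolding I_gens_def swap_gens_def by (elim UnE CollectE exE conjE)
  then show ?case
  proof cases
    case star
    have "w ` ({1..n} - {i}) = {1..n} - {w i}"
      using permutes_image[OF w] inj by (auto simp: image_set_diff)
    moreover have "inj_on w ({1..n} - {i})" using inj by (rule inj_on_subset) simp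
    ultimately have "(\<Sum>j\<in>{1..n} - {w i}. xvar {w i, j}) = (\<Sum>j\<in>{1..n} - {i}. xvar {w i, w j})"
      by (metis (no_types, lifting) sum.reindex_cong)
    then have "perm_poly w g = (\<Sum>j\<in>{1..n} - {w i}. xvar {w i, j})"
      unfolding star by (simp add: perm_poly_sum perm_poly_xvar)
    then show ?thesis using J_star[of "w i" n] star in_n by simp
  next
    case meet
    then have "w ` S \<inter> w ` T \<noteq> {}" by auto
    then show ?thesis
      unfolding meet perm_poly_mult perm_poly_xvar
      using meet edges_image[OF w] by (intro J_prod_intersecting)
  next
    case swap
    have "{w i, w j, w k, w l} \<subseteq> {1..n}" using swap(1) in_n by simp
    moreover have "distinct [w i, w j, w k, w l]" using swap(2) inj by (auto dest: injD)
    ultimately show ?thesis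
      using J_swap[of "w i" "w j" "w k" "w l" n]
      by (simp only: swap perm_poly_linear perm_poly_mult perm_poly_xvar image_insert image_empty)
  qed
qed (auto simp: perm_poly_add perm_poly_mult perm_poly_linear perm_poly_edge_polys[OF w])

lemma perm_poly_matching_poly:
  assumes "w permutes {1..n}"
  shows "perm_poly w (matching_poly P) = matching_poly ((`) w ` P)"
proof -
  have "inj ((`) w)" using permutes_inj[OF assms] by (simp add: inj_image_eq_iff inj_def)
  then have "inj_on ((`) w) P" by (rule inj_on_subset) simp
  then show ?thesis
    by (simp add: matching_poly_def perm_poly_prod perm_poly_xvar prod.reindex)
qed

lemma matching_image:
  assumes w: "w permutes {1..n}" and P: "matching n P"
  shows "matching n ((`) w ` P)"
proof -
  have "disjnt (w ` S) (w ` T)" if "S \<in> P" "T \<in> P" "w ` S \<noteq> w ` T" for S T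
  proof -
    have "S \<noteq> T" using that by auto
    then have "disjnt S T" using that P by (auto simp: matching_def pairwise_def)
    then show ?thesis using permutes_inj[OF w] by (auto simp: disjnt_def dest: injD)
  qed
  then have "pairwise disjnt ((`) w ` P)" by (auto simp: pairwise_def)
  then show ?thesis using P edges_image[OF w] by (auto simp: matching_def)
qed

lemma perm_poly_set_poly:
  assumes w: "w permutes {1..n}" and T: "T \<subseteq> {1..n}" "card T = 2 * d"
  shows "perm_poly w (set_poly n T) - set_poly n (w ` T) \<in> J_ideal n"
proof -
  obtain P where P: "matching n P" "\<Union>P = T" "card P = d" "set_poly n T = matching_poly P"
    by (rule set_poly_eq_matching_poly[OF T])
  have "\<Union>((`) w ` P) = w ` T" using P(2) by blast
  then show ?thesis
    using matching_poly_cong_set_poly[OF matching_image[OF w P(1)]]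
    by (simp add: P(4) perm_poly_matching_poly[OF w])
qed

lemma map_row_tabloid:
  "w permutes {1..n} \<Longrightarrow> map ((`) w) (row_tabloid n T) = row_tabloid n (w ` T)"
  using permutes_image[of w "{1..n}"] permutes_inj[of w "{1..n}"]
  by (simp add: row_tabloid_def image_set_diff)

lemma pushforward_alt:
  assumes w: "w permutes {1..n}"
  shows "pushforward (map ((`) w)) (alt ps {} (tabloid_vec n)) = alt (map (map_prod w w) ps) {} (tabloid_vec n)"
proof -
  have "pushforward (map ((`) w)) (alt ps {} (tabloid_vec n)) = alt ps {} (\<lambda>T. tabloid_vec n (w ` T))"
    by (subst alt_additive[where h = "pushforward (map ((`) w))"])
      (simp_all add: pushforward_diff map_row_tabloid[OF w])
  then show ?thesis using alt_map[of w ps "{}" "tabloid_vec n"] by (simp only: image_empty)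
qed

lemma pair_lists_map:
  assumes w: "w permutes {1..n}" and ps: "ps \<in> pair_lists n k"
  shows "map (map_prod w w) ps \<in> pair_lists n k"
proof -
  have ends: "ends (map (map_prod w w) ps) = map w (ends ps)"
    by (simp add: ends_def)
  have "inj_on w (set (ends ps))" using permutes_inj[OF w] by (rule inj_on_subset) simp
  moreover have "w ` set (ends ps) \<subseteq> {1..n}"
    using ps permutes_in_image[OF w] by (auto simp: pair_lists_def)
  ultimately show ?thesis using ps by (simp add: pair_lists_def ends distinct_map)
qed

lemma specht_space_act:
  assumes w: "w permutes {1..n}" and v: "v \<in> specht_space n k"
  shows "pushforward (map ((`) w)) v \<in> specht_space n k"
proof -
  let ?N = "{v. pushforward (map ((`) w)) v \<in> specht_space n k}"
  have "pm.subspace ?N"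
    using subspace_specht_space[of n k]
    by (auto simp: pm.subspace_def pushforward_add pushforward_pm_scale)
  with v have "v \<in> ?N"
  proof (rule specht_space_induct)
    fix ps assume "ps \<in> pair_lists n k"
    then show "alt ps {} (tabloid_vec n) \<in> ?N"
      using pair_lists_map[OF w] unfolding specht_space_def
      by (auto simp: pushforward_alt[OF w] intro!: pm.span_base)
  qed
  then show ?thesis by simp
qed

lemma alt_diff: "alt ps F \<phi> - alt ps F \<psi> = alt ps F (\<lambda>T. \<phi> T - \<psi> T)"
  by (induction ps F \<phi> rule: alt.induct) (simp_all add: algebra_simps flip: diff_diff_eq2)

text \<open>
  The two sides need not be equal, since the chosen matchings of \<open>T\<close> and \<open>w ` T\<close> are unrelated; they
  are congruent because both sides are matchings of \<open>w ` T\<close>.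
\<close>
lemma to_poly_equivariant:
  assumes w: "w permutes {1..n}" and v: "v \<in> specht_space n (2 * d)"
  shows "perm_poly w (to_poly n v) - to_poly n (pushforward (map ((`) w)) v) \<in> J_ideal n"
proof -
  let ?D = "\<lambda>v. perm_poly w (to_poly n v) - to_poly n (pushforward (map ((`) w)) v)"
  have "pm.subspace {v. ?D v \<in> J_ideal n}"
  proof (rule pm.subspaceI)
    fix u v assume "u \<in> {v. ?D v \<in> J_ideal n}" "v \<in> {v. ?D v \<in> J_ideal n}"
    moreover have "?D (u + v) = ?D u + ?D v"
      by (simp add: to_poly_simps perm_poly_add pushforward_add algebra_simps)
    ultimately show "u + v \<in> {v. ?D v \<in> J_ideal n}" by auto
  next
    fix c v assume "v \<in> {v. ?D v \<in> J_ideal n}"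
    moreover have "?D (pm_scale c v) = pm_scale c (?D v)"
      by (simp add: to_poly_simps perm_poly_linear pushforward_pm_scale pm.scale_right_diff_distrib)
    ultimately show "pm_scale c v \<in> {v. ?D v \<in> J_ideal n}" by auto
  qed (simp add: to_poly_simps perm_poly_linear)
  with v have "v \<in> {v. ?D v \<in> J_ideal n}"
  proof (rule specht_space_induct)
    fix ps assume ps: "ps \<in> pair_lists n (2 * d)"
    have "perm_poly w (to_poly n (alt ps {} (tabloid_vec n))) =
        alt ps {} (\<lambda>T. perm_poly w (set_poly n T))"
      unfolding to_poly_alt
      by (rule alt_additive) (rule perm_poly_linear)
    moreover have "to_poly n (pushforward (map ((`) w)) (alt ps {} (tabloid_vec n))) =
        alt ps {} (\<lambda>T. set_poly n (w ` T))"
      unfolding pushforward_alt[OF w] to_poly_alt using alt_map[of w ps "{}"] by simp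
    ultimately show "alt ps {} (tabloid_vec n) \<in> {v. ?D v \<in> J_ideal n}"
      using alt_mem[OF J_subspace ps perm_poly_set_poly[OF w]] by (simp add: alt_diff)
  qed
  then show ?thesis by simp
qed

section \<open>The graded components as modules\<close>

definition coset :: "nat \<Rightarrow> mpoly \<Rightarrow> mpoly set" where
  "coset n p = J_ideal n +>\<^bsub>edge_poly_ring n\<^esub> p"

lemma coset_alt: "coset n p = (\<lambda>h. h + p) ` J_ideal n"
  by (auto simp: coset_def a_r_coset_def')

lemma coset_eq_iff: "coset n p = coset n q \<longleftrightarrow> p - q \<in> J_ideal n"
proof
  assume "coset n p = coset n q"
  moreover have "p \<in> coset n p" by (force simp: coset_alt)
  ultimately have "p \<in> (\<lambda>h. h + q) ` J_ideal n" unfolding coset_alt by metis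
  then show "p - q \<in> J_ideal n" by auto
next
  assume pq: "p - q \<in> J_ideal n"
  have "coset n a \<subseteq> coset n b" if "a - b \<in> J_ideal n" for a b
  proof
    fix x assume "x \<in> coset n a"
    then obtain h where h: "h \<in> J_ideal n" "x = h + a" by (auto simp: coset_alt)
    then have "x = (h + (a - b)) + b" by simp
    then show "x \<in> coset n b" unfolding coset_alt using J_add[OF h(1) that] by blast
  qed
  moreover have "q - p \<in> J_ideal n" using J_uminus[OF pq] by simp
  ultimately show "coset n p = coset n q" using pq by blast
qed

text \<open>
  Stability of the ideal under \<open>w\<close> gives one inclusion; stability under the inverse of \<open>w\<close> gives the
  other one.
\<close>
lemma perm_poly_coset:
  assumes w: "w permutes {1..n}"
  shows "perm_poly w ` coset n p = coset n (perm_poly w p)"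
proof -
  have inv: "perm_poly w (perm_poly (inv_into UNIV w) q) = q" for q
    by (simp add: permutes_inv_o[OF w] flip: perm_poly_comp)
  have "perm_poly w ` J_ideal n = J_ideal n"
  proof
    show "perm_poly w ` J_ideal n \<subseteq> J_ideal n" using perm_poly_J[OF w] by blast
    show "J_ideal n \<subseteq> perm_poly w ` J_ideal n"
      using perm_poly_J[OF permutes_inv[OF w]] inv by (metis image_eqI subsetI)
  qed
  then have "coset n (perm_poly w p) = (\<lambda>h. h + perm_poly w p) ` perm_poly w ` J_ideal n"
    by (simp only: coset_alt)
  also have "\<dots> = perm_poly w ` coset n p"
    by (simp add: coset_alt image_image perm_poly_add)
  finally show ?thesis by simp
qed

lemma quotient_component_simps:
  "carrier (quotient_component n d) = coset n ` homog_space n d"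
  "zero (quotient_component n d) = coset n 0"
  "act (quotient_component n d) w U = perm_poly w ` U"
  by (auto simp: quotient_component_def quotient_module_def Let_def FactRing_def coset_def
      homog_space_def coset_alt[unfolded coset_def])

lemma quotient_component_add:
  assumes "p \<in> edge_polys n" "q \<in> edge_polys n"
  shows "coset n p \<oplus>\<^bsub>quotient_component n d\<^esub> coset n q = coset n (p + q)"
  using ideal.a_rcos_sum[OF ideal_J, of p n q] assms
  by (simp add: quotient_component_def quotient_module_def Let_def FactRing_def coset_def)

lemma quotient_component_smult:
  assumes "p \<in> edge_polys n"
  shows "c \<odot>\<^bsub>quotient_component n d\<^esub> coset n p = coset n (pm_scale c p)"
  using ideal.rcoset_mult_add[OF ideal_J, of "Poly_Mapping.single 0 c" n p] assms
  by (simp add: quotient_component_def quotient_module_def Let_def FactRing_def coset_def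
      single_0_mult)

lemma quotient_component_act:
  "w permutes {1..n} \<Longrightarrow> act (quotient_component n d) w (coset n p) = coset n (perm_poly w p)"
  using perm_poly_coset by (simp add: quotient_component_simps)

lemma homog_space_edge_polys: "p \<in> homog_space n d \<Longrightarrow> p \<in> edge_polys n"
  by (simp add: homog_space_def)

lemma homog_space_add: "p \<in> homog_space n d \<Longrightarrow> q \<in> homog_space n d \<Longrightarrow> p + q \<in> homog_space n d"
  by (rule pm.subspace_add[OF subspace_homog_space])

lemma homog_space_scale: "p \<in> homog_space n d \<Longrightarrow> pm_scale c p \<in> homog_space n d"
  by (rule pm.subspace_scale[OF subspace_homog_space])

lemmas component_simps = quotient_component_simps(1,2) quotient_component_act quotient_component_add quotient_component_smult
  homog_space_edge_polys homog_space_add homog_space_scale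

lemma Sn_module_quotient_component: "Sn_module n (quotient_component n d)"
proof -
  have "abelian_group (quotient_component n d)"
  proof (rule abelian_groupI)
    show "\<zero>\<^bsub>quotient_component n d\<^esub> \<in> carrier (quotient_component n d)"
      using pm.subspace_0[OF subspace_homog_space] by (auto simp: component_simps)
    fix x assume "x \<in> carrier (quotient_component n d)"
    then obtain p where p: "x = coset n p" "p \<in> homog_space n d" by (auto simp: component_simps)
    have "- p \<in> homog_space n d" using pm.subspace_neg[OF subspace_homog_space p(2)] .
    then show "\<exists>y\<in>carrier (quotient_component n d).
        y \<oplus>\<^bsub>quotient_component n d\<^esub> x = \<zero>\<^bsub>quotient_component n d\<^esub>"
      using p by (intro bexI[of _ "coset n (- p)"]) (auto simp: component_simps)
  qed (auto simp: component_simps ac_simps edge_polys_add)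
  moreover have "cring (ring_of_type_algebra :: complex ring)" by (rule cring_from_type_algebra)
  ultimately have "module (ring_of_type_algebra :: complex ring) (quotient_component n d)"
    by (intro moduleI)
      (auto simp: component_simps ring_of_type_algebra_def pm.scale_left_distrib
        pm.scale_right_distrib edge_polys_pm_scale edge_polys_add)
  then show ?thesis
    by (intro Sn_module.intro Sn_module_axioms.intro)
      (auto simp: component_simps perm_poly_homog perm_poly_edge_polys perm_poly_add
        perm_poly_linear perm_poly_comp permutes_compose permutes_id edge_polys_add edge_polys_pm_scale)
qed

text \<open>
  The Specht module is a system of representatives for the component: injectivity is the trivial
  intersection with the ideal, surjectivity the reduction of homogeneous polynomials.
\<close>
lemma bij_to_component:
  "bij_betw (\<lambda>v. coset n (to_poly n v)) (specht_space n (2 * d)) (carrier (quotient_component n d))"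
proof (rule bij_betwI')
  fix u v assume uv: "u \<in> specht_space n (2 * d)" "v \<in> specht_space n (2 * d)"
  have "u = v" if "to_poly n u - to_poly n v \<in> J_ideal n"
    using to_poly_mem_J_imp_0[of "u - v" n d] that uv pm.subspace_diff[OF subspace_specht_space uv]
    by (simp add: to_poly_simps)
  then show "coset n (to_poly n u) = coset n (to_poly n v) \<longleftrightarrow> u = v"
    by (auto simp: coset_eq_iff)
next
  fix v assume "v \<in> specht_space n (2 * d)"
  then show "coset n (to_poly n v) \<in> carrier (quotient_component n d)"
    using to_poly_homog by (auto simp: component_simps)
next
  fix x assume "x \<in> carrier (quotient_component n d)"
  then obtain p where p: "x = coset n p" "p \<in> homog_space n d" by (auto simp: component_simps)
  then show "\<exists>v\<in>specht_space n (2 * d). x = coset n (to_poly n v)"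
    using homog_space_reduces[OF p(2)] by (auto simp: coset_eq_iff)
qed

lemma two_row_partition: "n > 0 \<Longrightarrow> 2 * k \<le> n \<Longrightarrow> two_row n k \<in> partitions n"
  by (auto simp: two_row_def partitions_def)

text \<open>
  If \<open>n < 2 * k\<close>, all multiplicities are zero, and so is \<open>specht_space n k\<close>; both sides consist of
  the zero function, so that zero components can be treated like the other ones.
\<close>
lemma carrier_specht_sum_single:
  fixes n k :: nat
  assumes "n > 0"
  defines "c \<equiv> \<lambda>lam. if 2 * k \<le> n \<and> lam = two_row n k then 1 else 0 :: nat"
  shows "carrier (specht_sum n c) =
    (\<lambda>v lam i. if lam = two_row n k \<and> i = (0 :: nat) then v else 0) ` specht_space n k"
    (is "_ = ?e ` _")
proof (cases "2 * k \<le> n")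
  case True
  have part: "two_row n k \<in> partitions n" using assms(1) True by (rule two_row_partition)
  have carr: "carrier (specht n (two_row n k)) = specht_space n k"
    using carrier_specht_two_row[OF True] by (simp add: specht_space_def)
  show ?thesis
  proof (rule subset_antisym; rule subsetI)
    fix f assume "f \<in> carrier (specht_sum n c)"
    then have f: "if lam \<in> partitions n \<and> i < c lam then f lam i \<in> carrier (specht n lam)
        else f lam i = 0" for lam i by (simp add: specht_sum_def)
    have "f (two_row n k) 0 \<in> specht_space n k"
      using f[of "two_row n k" 0] part carr True by (simp add: c_def)
    moreover have "f = ?e (f (two_row n k) 0)"
    proof (intro ext)
      fix lam i
      show "f lam i = ?e (f (two_row n k) 0) lam i"
        using f[of lam i] by (auto simp: c_def split: if_splits)
    qed
    ultimately show "f \<in> ?e ` specht_space n k" by blast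
  next
    fix f assume "f \<in> ?e ` specht_space n k"
    then obtain v where v: "v \<in> specht_space n k" and f: "f = ?e v" by blast
    have "if lam \<in> partitions n \<and> i < c lam then f lam i \<in> carrier (specht n lam)
        else f lam i = 0" for lam i
      using part carr True v by (cases "lam = two_row n k") (simp_all add: f c_def)
    then show "f \<in> carrier (specht_sum n c)" by (simp add: specht_sum_def)
  qed
next
  case False
  then have "carrier (specht_sum n c) = {\<lambda>lam i. 0}"
    by (simp add: specht_sum_def c_def set_eq_iff fun_eq_iff)
  moreover have "?e ` specht_space n k = {\<lambda>lam i. 0}"
    using False by (subst specht_space_trivial) auto
  ultimately show ?thesis by simp
qed

lemma finite_partitions: "finite (partitions n)"
proof (rule finite_subset)
  show "partitions n \<subseteq> {xs. set xs \<subseteq> {..n} \<and> length xs \<le> n}"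
  proof
    fix xs assume xs: "xs \<in> partitions n"
    have "length xs \<le> sum_list xs" if "0 \<notin> set xs" for xs :: "nat list"
      using that by (induction xs) auto
    moreover have "x \<le> sum_list xs" if "x \<in> set xs" for x
      using that by (intro member_le_sum_list) auto
    ultimately show "xs \<in> {xs. set xs \<subseteq> {..n} \<and> length xs \<le> n}"
      using xs by (auto simp: partitions_def)
  qed
qed (simp add: finite_lists_length_le)

lemma schur_two_row: "schur [n - k, k] = schur (two_row n k)"
proof -
  have "young [n - k, k] = young (two_row n k)"
    unfolding young_two_row by (auto simp: young_def nth_Cons split: nat.splits)
  then show ?thesis by (simp add: schur_def ssyt_def)
qed

text \<open>
  The Frobenius image only asks for an isomorphism from the component to a sum of Specht modules, so
  the inverse of the bijection \<open>bij_to_component\<close> is used, followed by the embedding \<open>e\<close> of the Specht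
  module as the only summand.
\<close>
lemma has_Frob_quotient_component:
  assumes n: "n > 0"
  shows "has_Frob n (quotient_component n d) (if d \<le> n div 4 then schur [n - 2 * d, 2 * d] else 0)"
proof -
  let ?S = "specht_space n (2 * d)" and ?V = "quotient_component n d"
  let ?g = "\<lambda>v. coset n (to_poly n v)"
  define lam0 where "lam0 = two_row n (2 * d)"
  define e where "e = (\<lambda>(v :: nat set list \<Rightarrow>\<^sub>0 complex) lam i. if lam = lam0 \<and> i = (0 :: nat) then v else 0)"
  define c where "c = (\<lambda>lam. if 2 * (2 * d) \<le> n \<and> lam = lam0 then 1 else 0 :: nat)"
  define h where "h = (\<lambda>U. e (inv_into ?S ?g U))"
  let ?W = "specht_sum n c"
  have carr: "carrier ?W = e ` ?S"
    using carrier_specht_sum_single[OF n, of "2 * d"] by (simp add: c_def e_def lam0_def)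
  have h: "h (?g v) = e v" if "v \<in> ?S" for v
    unfolding h_def inv_into_f_f[OF bij_betw_imp_inj_on[OF bij_to_component] that] ..
  have rep: "\<exists>v\<in>?S. U = ?g v" if "U \<in> carrier ?V" for U
    using that bij_betw_imp_surj_on[OF bij_to_component[of n d]] by blast
  have edge_polys: "to_poly n v \<in> edge_polys n" if "v \<in> ?S" for v using to_poly_homog[OF that] homog_space_edge_polys by blast
  have "Sn_iso n ?V ?W"
    unfolding Sn_iso_def
  proof (intro exI[of _ h] conjI ballI allI impI)
    have "inj_on e ?S" by (rule inj_onI) (auto simp: e_def fun_eq_iff split: if_splits)
    then have "bij_betw e ?S (carrier ?W)" by (simp add: carr bij_betw_def)
    from bij_betw_trans[OF bij_betw_inv_into[OF bij_to_component[of n d]] this]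
    show "bij_betw h (carrier ?V) (carrier ?W)" by (simp add: h_def o_def)
  next
    fix U U' assume "U \<in> carrier ?V" "U' \<in> carrier ?V"
    then obtain u v where uv: "u \<in> ?S" "v \<in> ?S" "U = ?g u" "U' = ?g v" using rep by metis
    then have "U \<oplus>\<^bsub>?V\<^esub> U' = ?g (u + v)" using edge_polys by (simp add: component_simps to_poly_simps)
    moreover have "e (u + v) = e u \<oplus>\<^bsub>?W\<^esub> e v" by (auto simp: e_def specht_sum_def specht_def fun_eq_iff)
    ultimately show "h (U \<oplus>\<^bsub>?V\<^esub> U') = h U \<oplus>\<^bsub>?W\<^esub> h U'"
      using uv h pm.subspace_add[OF subspace_specht_space] by simp
  next
    fix a U assume "U \<in> carrier ?V"
    then obtain v where v: "v \<in> ?S" "U = ?g v" using rep by metis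
    then have "a \<odot>\<^bsub>?V\<^esub> U = ?g (pm_scale a v)" using edge_polys by (simp add: component_simps to_poly_simps)
    moreover have "e (pm_scale a v) = a \<odot>\<^bsub>?W\<^esub> e v" by (auto simp: e_def specht_sum_def specht_def fun_eq_iff)
    ultimately show "h (a \<odot>\<^bsub>?V\<^esub> U) = a \<odot>\<^bsub>?W\<^esub> h U"
      using v h pm.subspace_scale[OF subspace_specht_space] by simp
  next
    fix w U assume w: "w permutes {1..n}" and "U \<in> carrier ?V"
    then obtain v where v: "v \<in> ?S" "U = ?g v" using rep by metis
    have "act ?V w U = ?g (pushforward (map ((`) w)) v)"
      using to_poly_equivariant[OF w v(1)] v
      by (simp add: quotient_component_act[OF w] coset_eq_iff)
    moreover have "e (pushforward (map ((`) w)) v) = act ?W w (e v)"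
      by (auto simp: e_def specht_sum_def specht_def fun_eq_iff)
    ultimately show "h (act ?V w U) = act ?W w (h U)"
      using v h specht_space_act[OF w v(1)] by simp
  qed
  moreover have "(if d \<le> n div 4 then schur [n - 2 * d, 2 * d] else 0) =
      (\<lambda>m. \<Sum>lam\<in>partitions n. int (c lam) * schur lam m)"
  proof (cases "4 * d \<le> n")
    case True
    have "lam0 \<in> partitions n" unfolding lam0_def using n True by (intro two_row_partition) auto
    then have "(\<Sum>lam\<in>partitions n. int (c lam) * schur lam m) = schur lam0 m" for m
      using finite_partitions True
      by (subst sum.mono_neutral_right[of _ "{lam0}"]) (auto simp: c_def)
    then show ?thesis using True by (simp add: schur_two_row lam0_def fun_eq_iff)
  next
    case False
    then show ?thesis by (auto simp: c_def fun_eq_iff)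
  qed
  ultimately show ?thesis
    unfolding has_Frob_def using Sn_module_quotient_component by blast
qed

theorem theorem3p15:
  fixes n :: nat
  assumes "n > 0"
  shows "has_grFrob n (quotient_component n)
    (\<Sum>d = 0..n div 4. Polynomial.monom (schur [n - 2 * d, 2 * d]) d)"
proof -
  have "Polynomial.coeff (\<Sum>d = 0..n div 4. Polynomial.monom (schur [n - 2 * d, 2 * d]) d) d =
      (if d \<le> n div 4 then schur [n - 2 * d, 2 * d] else 0)" for d
    by (simp add: coeff_sum when_def)
  then show ?thesis
    unfolding has_grFrob_def using has_Frob_quotient_component[OF assms] by simp
qed

end
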